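(* Let $G$ be a finite group in which every maximal subgroup is nilpotent or normal in $G$. Then for each prime divisor $q$ of $|G|$, $G$ is $q$-nilpotent or $q$-closed.
   Context: For a prime $q$, a finite group $G$ is $q$-nilpotent if it has a normal $q$-complement (a normal subgroup of order coprime to $q$ and index a power of $q$), and $q$-closed if its Sylow $q$-subgroup is normal in $G$. *)

theory Defs
  imports "HOL-Algebra.Algebra" "HOL-Computational_Algebra.Primes"
begin

primrec lower_central :: "('a, 'b) monoid_scheme \<Rightarrow> nat \<Rightarrow> 'a set" where
  "lower_central G 0 = carrier G"
| "lower_central G (Suc n) =
     generate G {x \<otimes>\<^bsub>G\<^esub> y \<otimes>\<^bsub>G\<^esub> inv\<^bsub>G\<^esub> x \<otimes>\<^bsub>G\<^esub> inv\<^bsub>G\<^esub> y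
                 | x y. x \<in> lower_central G n \<and> y \<in> carrier G}"

definition nilpotent_group :: "('a, 'b) monoid_scheme \<Rightarrow> bool" where
  "nilpotent_group G \<longleftrightarrow> (\<exists>n. lower_central G n = {\<one>\<^bsub>G\<^esub>})"

definition maximal_subgroup :: "'a set \<Rightarrow> ('a, 'b) monoid_scheme \<Rightarrow> bool" where
  "maximal_subgroup M G \<longleftrightarrow> subgroup M G \<and> M \<noteq> carrier G \<and>
     (\<forall>H. subgroup H G \<and> M \<subseteq> H \<longrightarrow> H = M \<or> H = carrier G)"

definition q_nilpotent :: "('a, 'b) monoid_scheme \<Rightarrow> nat \<Rightarrow> bool" where
  "q_nilpotent G q \<longleftrightarrow> (\<exists>N. N \<lhd> G \<and> coprime (card N) q \<and>
     (\<exists>k. card (carrier G) = card N * q ^ k))"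

definition q_closed :: "('a, 'b) monoid_scheme \<Rightarrow> nat \<Rightarrow> bool" where
  "q_closed G q \<longleftrightarrow> (\<exists>P. subgroup P G \<and> card P = q ^ multiplicity q (card (carrier G)) \<and> P \<lhd> G)"

end

theory Submission
  imports Defs
begin

text \<open>
  Take a counterexample all of whose proper quotients are \<open>q\<close>-nilpotent or \<open>q\<close>-closed. By
  Frattini's argument the normalizer of a non-normal Sylow subgroup is a nilpotent maximal subgroup.
  If \<open>H \<noteq> 1\<close> is a normal \<open>q'\<close>-subgroup, then \<open>G / H\<close> is \<open>q\<close>-closed, so \<open>G = H M\<close> with
  \<open>M = N(Q)\<close> nilpotent, and \<open>H\<close> times the \<open>q\<close>-complement of \<open>M\<close> is a normal \<open>q\<close>-complement of \<open>G\<close>.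
  If \<open>U \<noteq> 1\<close> is a normal \<open>q\<close>-subgroup, then \<open>G / U\<close> is \<open>q\<close>-nilpotent with complement \<open>T / U\<close>, every
  Sylow subgroup for a prime other than \<open>q\<close> centralizes \<open>U\<close>, and the transfer of \<open>T \<inter> C(U)\<close> into its
  central Hall subgroup \<open>U \<inter> C(U)\<close> yields a normal \<open>q'\<close>-subgroup. Hence \<open>G\<close> has no nontrivial normal
  subgroup of prime power order. Then every non-normal maximal subgroup is a Hall subgroup equal to
  the normalizer of each of its Sylow subgroups, there are two of them of coprime orders, and this
  forces \<open>G\<close> to be simple. Now all maximal subgroups are nilpotent, so distinct ones intersect
  trivially, and two conjugacy classes of them already cover too many elements.
\<close>

section \<open>Conjugation and normalizers\<close>

locale finite_group = group G for G (structure) +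
  assumes fin [simp]: "finite (carrier G)"
begin

definition conjs :: "'a \<Rightarrow> 'a set \<Rightarrow> 'a set" where
  "conjs g H = (\<lambda>h. g \<otimes> h \<otimes> inv g) ` H"

text \<open>The normalizer N_G(H). That L normalizes H is written
  \<open>L \<subseteq> normalizing H\<close>, which expresses relative normality without changing
  the carrier.\<close>

definition normalizing :: "'a set \<Rightarrow> 'a set" where
  "normalizing H = {g \<in> carrier G. conjs g H = H}"

lemma subgroup_finite: "subgroup H G \<Longrightarrow> finite H"
  using fin finite_subset subgroup.subset by blast

lemma subgroup_card_pos: "subgroup H G \<Longrightarrow> card H > 0"
  using fin subgroup.finite_imp_card_positive by blast

lemma subgroup_one: "subgroup H G \<Longrightarrow> \<one> \<in> H"
  by (rule subgroup.one_closed)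

lemma conj_mult:
  assumes "g \<in> carrier G" "k \<in> carrier G" "h \<in> carrier G"
  shows "(g \<otimes> k) \<otimes> h \<otimes> inv (g \<otimes> k) = g \<otimes> (k \<otimes> h \<otimes> inv k) \<otimes> inv g"
  using assms by (simp add: m_assoc inv_mult_group)

lemma conj_hom:
  assumes "g \<in> carrier G" "k \<in> carrier G" "h \<in> carrier G"
  shows "g \<otimes> (h \<otimes> k) \<otimes> inv g = (g \<otimes> h \<otimes> inv g) \<otimes> (g \<otimes> k \<otimes> inv g)"
proof -
  have "inv g \<otimes> (g \<otimes> (k \<otimes> inv g)) = k \<otimes> inv g"
    using assms by (metis inv_solve_left m_closed inv_closed)
  then show ?thesis using assms by (simp add: m_assoc)
qed

lemma conj_inv:
  assumes "g \<in> carrier G" "h \<in> carrier G"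
  shows "inv (g \<otimes> h \<otimes> inv g) = g \<otimes> inv h \<otimes> inv g"
  using assms by (simp add: m_assoc inv_mult_group)

lemma conjs_mult:
  assumes "g \<in> carrier G" "k \<in> carrier G" "H \<subseteq> carrier G"
  shows "conjs (g \<otimes> k) H = conjs g (conjs k H)"
  unfolding conjs_def image_image using conj_mult assms by (intro image_cong) auto

lemma conjs_one: "H \<subseteq> carrier G \<Longrightarrow> conjs \<one> H = H"
  unfolding conjs_def by (force simp: subset_iff image_iff)

lemma conjs_mono: "H \<subseteq> K \<Longrightarrow> conjs g H \<subseteq> conjs g K"
  unfolding conjs_def by auto

lemma conjs_carrier: "g \<in> carrier G \<Longrightarrow> H \<subseteq> carrier G \<Longrightarrow> conjs g H \<subseteq> carrier G"
  unfolding conjs_def by auto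

lemma conjs_inv1: "g \<in> carrier G \<Longrightarrow> H \<subseteq> carrier G \<Longrightarrow> conjs (inv g) (conjs g H) = H"
  using conjs_mult[of "inv g" g H] conjs_one by simp

lemma conjs_inv2: "g \<in> carrier G \<Longrightarrow> H \<subseteq> carrier G \<Longrightarrow> conjs g (conjs (inv g) H) = H"
  using conjs_mult[of g "inv g" H] conjs_one by simp

lemma inj_conj: "g \<in> carrier G \<Longrightarrow> H \<subseteq> carrier G \<Longrightarrow> inj_on (\<lambda>h. g \<otimes> h \<otimes> inv g) H"
  by (rule inj_onI) (simp add: subset_iff)

lemma card_conjs: "g \<in> carrier G \<Longrightarrow> H \<subseteq> carrier G \<Longrightarrow> card (conjs g H) = card H"
  unfolding conjs_def by (rule card_image[OF inj_conj])

lemma conjs_subgroup: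
  assumes g: "g \<in> carrier G" and H: "subgroup H G"
  shows "subgroup (conjs g H) G"
proof (rule subgroupI)
  note sub = subgroup.subset[OF H]
  show "conjs g H \<subseteq> carrier G" using conjs_carrier[OF g sub] .
  show "conjs g H \<noteq> {}" using subgroup_one[OF H] by (auto simp: conjs_def)
  show "inv a \<in> conjs g H" if a: "a \<in> conjs g H" for a
  proof -
    obtain h where h: "h \<in> H" "a = g \<otimes> h \<otimes> inv g" using a unfolding conjs_def by blast
    then have "inv a = g \<otimes> inv h \<otimes> inv g" using conj_inv[OF g] sub by auto
    moreover have "inv h \<in> H" using h H by (simp add: subgroup.m_inv_closed)
    ultimately show ?thesis unfolding conjs_def by blast
  qed
  show "a \<otimes> b \<in> conjs g H" if a: "a \<in> conjs g H" "b \<in> conjs g H" for a b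
  proof -
    obtain h k where h: "h \<in> H" "a = g \<otimes> h \<otimes> inv g" "k \<in> H" "b = g \<otimes> k \<otimes> inv g"
      using a unfolding conjs_def by blast
    then have "a \<otimes> b = g \<otimes> (h \<otimes> k) \<otimes> inv g" using conj_hom[OF g, of k h] sub by (metis subsetD)
    moreover have "h \<otimes> k \<in> H" using h H by (simp add: subgroup.m_closed)
    ultimately show ?thesis unfolding conjs_def by blast
  qed
qed

lemma conjs_subset_subgroup:
  assumes "subgroup L G" "g \<in> L" "H \<subseteq> L"
  shows "conjs g H \<subseteq> L"
  using assms by (auto simp: conjs_def intro!: subgroup.m_closed subgroup.m_inv_closed)

lemma normalizing_subset: "normalizing H \<subseteq> carrier G"
  by (auto simp: normalizing_def)

text \<open>Conjugation preserves the order, so in a finite group one inclusion already forces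
  equality.\<close>

lemma normalizingI:
  assumes "subgroup H G" "g \<in> carrier G" "conjs g H \<subseteq> H"
  shows "g \<in> normalizing H"
proof -
  have "conjs g H = H"
    using card_subset_eq[OF subgroup_finite[OF assms(1)] assms(3)] card_conjs assms subgroup.subset
    by metis
  then show ?thesis using assms by (simp add: normalizing_def)
qed

lemma normalizingD:
  assumes "g \<in> normalizing H" "h \<in> H"
  shows "g \<otimes> h \<otimes> inv g \<in> H"
  using assms by (auto simp: normalizing_def conjs_def)

lemma subgroup_normalizing:
  assumes "H \<subseteq> carrier G"
  shows "subgroup (normalizing H) G"
proof (rule subgroupI)
  show "normalizing H \<subseteq> carrier G" by (rule normalizing_subset)
  show "normalizing H \<noteq> {}" using conjs_one[OF assms] by (auto simp: normalizing_def)
  show "inv a \<in> normalizing H" if "a \<in> normalizing H" for a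
    using that conjs_inv1[of a H] assms by (auto simp: normalizing_def)
  show "a \<otimes> b \<in> normalizing H" if "a \<in> normalizing H" "b \<in> normalizing H" for a b
    using that conjs_mult[of a b H] assms by (auto simp: normalizing_def)
qed

lemma subset_normalizing: "subgroup H G \<Longrightarrow> H \<subseteq> normalizing H"
  using normalizingI conjs_subset_subgroup[of H _ H] subgroup.subset by blast

lemma normal_iff_normalizing: "N \<lhd> G \<longleftrightarrow> subgroup N G \<and> carrier G \<subseteq> normalizing N"
proof
  assume n: "N \<lhd> G"
  then have s: "subgroup N G" by (rule normal_imp_subgroup)
  moreover have "g \<in> normalizing N" if "g \<in> carrier G" for g
    by (rule normalizingI[OF s that])
      (use that n in \<open>auto simp: conjs_def normal.inv_op_closed2\<close>)
  ultimately show "subgroup N G \<and> carrier G \<subseteq> normalizing N" by auto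
next
  assume "subgroup N G \<and> carrier G \<subseteq> normalizing N"
  then show "N \<lhd> G" using normal_inv_iff normalizingD by blast
qed

lemma normal_conjs: "N \<lhd> G \<Longrightarrow> g \<in> carrier G \<Longrightarrow> conjs g N = N"
  unfolding normal_iff_normalizing by (auto simp: normalizing_def)

lemma normalizing_normal: "N \<lhd> G \<Longrightarrow> normalizing N = carrier G"
  unfolding normal_iff_normalizing using normalizing_subset by blast

lemma normalizing_Int:
  assumes "subgroup H G" "subgroup K G"
  shows "normalizing H \<inter> normalizing K \<subseteq> normalizing (H \<inter> K)"
proof
  fix g assume g: "g \<in> normalizing H \<inter> normalizing K"
  show "g \<in> normalizing (H \<inter> K)"
  proof (rule normalizingI)
    show "subgroup (H \<inter> K) G" using assms by (rule subgroups_Inter_pair)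
    show "g \<in> carrier G" using g normalizing_subset by auto
    show "conjs g (H \<inter> K) \<subseteq> H \<inter> K" using g normalizingD by (auto simp: conjs_def)
  qed
qed

section \<open>Orders of subgroups and the product formula\<close>

lemma card_subgroup_dvd:
  assumes H: "subgroup H G" and K: "subgroup K G" and sub: "H \<subseteq> K"
  shows "card H dvd card K"
proof -
  interpret K: group "G\<lparr>carrier := K\<rparr>" using K by (rule subgroup_imp_group)
  have "subgroup H (G\<lparr>carrier := K\<rparr>)" using subgroup_incl[OF H K sub] .
  from K.lagrange[OF this] show ?thesis by (simp add: order_def) (metis dvd_triv_left mult.commute)
qed

lemma card_subgroup_dvd_carrier: "subgroup H G \<Longrightarrow> card H dvd card (carrier G)"
  using card_subgroup_dvd subgroup_self subgroup.subset by blast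

lemma subgroup_eqI:
  assumes "subgroup H G" "subgroup K G" "H \<subseteq> K" "card K \<le> card H"
  shows "H = K"
  using assms by (simp add: card_seteq subgroup_finite)

lemma set_mult_subset_carrier: "subgroup H G \<Longrightarrow> subgroup K G \<Longrightarrow> H <#> K \<subseteq> carrier G"
  by (simp add: setmult_subset_G subgroup.subset)

text \<open>Counts the pairs in H x K by their products: the pairs with product hk are exactly (hd,
  d^-1 k) for d in the intersection of H and K.\<close>

lemma card_set_mult:
  assumes H: "subgroup H G" and K: "subgroup K G"
  shows "card (H <#> K) * card (H \<inter> K) = card H * card K"
proof -
  note c = subgroup.mem_carrier[OF H] subgroup.mem_carrier[OF K]
  define f where "f = (\<lambda>(h, k). h \<otimes> k)"
  have fib: "card {p \<in> H \<times> K. f p = y} = card (H \<inter> K)" if y: "y \<in> H <#> K" for y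
  proof -
    obtain h k where hk: "h \<in> H" "k \<in> K" "y = h \<otimes> k" using y unfolding set_mult_def by blast
    have "bij_betw (\<lambda>d. (h \<otimes> d, inv d \<otimes> k)) (H \<inter> K) {p \<in> H \<times> K. f p = y}"
      unfolding bij_betw_def
    proof
      show "inj_on (\<lambda>d. (h \<otimes> d, inv d \<otimes> k)) (H \<inter> K)"
        by (rule inj_onI) (metis IntD1 Pair_inject c(1) hk(1) l_cancel)
      show "(\<lambda>d. (h \<otimes> d, inv d \<otimes> k)) ` (H \<inter> K) = {p \<in> H \<times> K. f p = y}" (is "?L = ?R")
      proof (intro equalityI subsetI)
        fix p assume "p \<in> ?L"
        then obtain d where d: "d \<in> H" "d \<in> K" "p = (h \<otimes> d, inv d \<otimes> k)" by blast
        have "h \<otimes> d \<otimes> (inv d \<otimes> k) = h \<otimes> (d \<otimes> (inv d \<otimes> k))"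
          using c hk d by (simp only: m_assoc m_closed inv_closed)
        also have "d \<otimes> (inv d \<otimes> k) = k"
          using c hk d by (metis inv_closed r_inv m_assoc l_one)
        finally have "f p = y" by (simp add: f_def d hk)
        then show "p \<in> ?R"
          using d hk H K by (simp add: subgroup.m_closed subgroup.m_inv_closed)
      next
        fix p assume p: "p \<in> ?R"
        then obtain a b where ab: "p = (a, b)" "a \<in> H" "b \<in> K" by blast
        then have e: "a \<otimes> b = h \<otimes> k" using p hk by (simp add: f_def)
        define d where "d = inv h \<otimes> a"
        have dH: "d \<in> H" using ab hk H by (simp add: d_def subgroup.m_closed subgroup.m_inv_closed)
        have "d \<otimes> b = k" using e ab hk c by (metis d_def inv_closed inv_solve_left m_assoc m_closed)
        then have d: "d = k \<otimes> inv b" using ab hk c dH by (metis inv_solve_right)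
        then have dK: "d \<in> K" using ab hk K by (simp add: subgroup.m_closed subgroup.m_inv_closed)
        have "h \<otimes> d = a" using ab hk c by (metis d_def inv_closed inv_solve_left m_closed)
        moreover have "inv d \<otimes> k = b" using \<open>d \<otimes> b = k\<close> ab hk c dK by (metis inv_solve_left)
        ultimately show "p \<in> ?L" using ab dH dK by blast
      qed
    qed
    then show ?thesis by (rule bij_betw_same_card[symmetric])
  qed
  have finHK: "finite (H \<times> K)" using H K subgroup_finite by blast
  have im: "H <#> K = f ` (H \<times> K)" by (force simp: set_mult_def f_def)
  have "card (H \<times> K) = (\<Sum>y\<in>f ` (H \<times> K). card {p \<in> H \<times> K. f p = y})"
    using sum.image_gen[OF finHK, of "\<lambda>_. 1::nat" f] by (simp only: card_eq_sum)
  then show ?thesis using fib im by (simp add: card_cartesian_product)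
qed

end

section \<open>Sylow subgroups\<close>

lemma multiplicity_prime_power_mult:
  fixes p :: nat
  assumes "Factorial_Ring.prime p" "\<not> p dvd m"
  shows "multiplicity p (p ^ k * m) = k"
proof (rule multiplicity_eqI)
  show "\<not> p ^ Suc k dvd p ^ k * m" using assms prime_gt_0_nat[of p] by simp
qed simp

context finite_group
begin

section \<open>Products of subgroups\<close>

lemma set_mult_memI: "h \<in> H \<Longrightarrow> k \<in> K \<Longrightarrow> h \<otimes> k \<in> H <#> K"
  unfolding set_mult_def by blast

lemma subset_set_mult:
  assumes "subgroup H G" "subgroup K G"
  shows "H \<subseteq> H <#> K" "K \<subseteq> H <#> K"
proof -
  show "H \<subseteq> H <#> K"
    using set_mult_memI[of _ H \<one> K] subgroup_one[OF assms(2)] subgroup.mem_carrier[OF assms(1)] by fastforce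
  show "K \<subseteq> H <#> K"
    using set_mult_memI[of \<one> H _ K] subgroup_one[OF assms(1)] subgroup.mem_carrier[OF assms(2)] by fastforce
qed

text \<open>Since H normalizes K, elements of K can be moved past elements of H by k h' = h' (h'^-1
  k h').\<close>

lemma subgroup_set_mult:
  assumes H: "subgroup H G" and K: "subgroup K G" and n: "H \<subseteq> normalizing K"
  shows "subgroup (H <#> K) G"
proof (rule subgroupI)
  note c = subgroup.mem_carrier[OF H] subgroup.mem_carrier[OF K]
  show "H <#> K \<subseteq> carrier G" using set_mult_subset_carrier[OF H K] .
  show "H <#> K \<noteq> {}" using subset_set_mult[OF H K] subgroup_one[OF H] by blast
  have inv_conj: "inv h \<otimes> k \<otimes> h \<in> K" if "h \<in> H" "k \<in> K" for h k
  proof -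
    have "inv h \<in> normalizing K" using that H n subgroup.m_inv_closed by fastforce
    from normalizingD[OF this that(2)] show ?thesis using c that by simp
  qed
  show "inv a \<in> H <#> K" if a: "a \<in> H <#> K" for a
  proof -
    obtain h k where hk: "h \<in> H" "k \<in> K" "a = h \<otimes> k" using a unfolding set_mult_def by blast
    have "inv a = inv h \<otimes> (h \<otimes> inv k \<otimes> inv h)"
      using hk c by (simp add: inv_mult_group m_assoc[symmetric])
    moreover have "h \<otimes> inv k \<otimes> inv h \<in> K"
      using hk n normalizingD K subgroup.m_inv_closed by fastforce
    ultimately show ?thesis using hk H by (metis set_mult_memI subgroup.m_inv_closed)
  qed
  show "a \<otimes> b \<in> H <#> K" if a: "a \<in> H <#> K" "b \<in> H <#> K" for a b
  proof -
    obtain h k h' k' where hk: "h \<in> H" "k \<in> K" "a = h \<otimes> k" "h' \<in> H" "k' \<in> K" "b = h' \<otimes> k'"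
      using a unfolding set_mult_def by blast
    have "(h \<otimes> h') \<otimes> ((inv h' \<otimes> k \<otimes> h') \<otimes> k') = h \<otimes> (h' \<otimes> inv h') \<otimes> k \<otimes> h' \<otimes> k'"
      using hk c by (simp only: m_assoc m_closed inv_closed)
    also have "\<dots> = a \<otimes> b" using hk c by (simp add: m_assoc)
    finally have "a \<otimes> b = (h \<otimes> h') \<otimes> ((inv h' \<otimes> k \<otimes> h') \<otimes> k')" by simp
    then show ?thesis
      using hk H K inv_conj[of h' k] by (metis set_mult_memI subgroup.m_closed)
  qed
qed

lemma normalizing_set_mult:
  assumes H: "subgroup H G" and K: "subgroup K G" and HK: "subgroup (H <#> K) G"
  shows "normalizing H \<inter> normalizing K \<subseteq> normalizing (H <#> K)"
proof
  fix g assume g: "g \<in> normalizing H \<inter> normalizing K"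
  then have gc: "g \<in> carrier G" using normalizing_subset by blast
  show "g \<in> normalizing (H <#> K)"
  proof (rule normalizingI[OF HK gc], rule subsetI)
    fix a assume "a \<in> conjs g (H <#> K)"
    then obtain h k where hk: "h \<in> H" "k \<in> K" "a = g \<otimes> (h \<otimes> k) \<otimes> inv g"
      unfolding conjs_def set_mult_def by blast
    then have "a = (g \<otimes> h \<otimes> inv g) \<otimes> (g \<otimes> k \<otimes> inv g)"
      using conj_hom[OF gc, of k h] subgroup.mem_carrier[OF H] subgroup.mem_carrier[OF K] by metis
    then show "a \<in> H <#> K" using hk g normalizingD set_mult_memI by (metis IntD1 IntD2)
  qed
qed

section \<open>Double cosets, conjugacy of Sylow subgroups and the Frattini argument\<close>

lemma p_subgroup_sub:
  assumes "Factorial_Ring.prime p" "subgroup H G" "subgroup K G" "H \<subseteq> K" "card K = p ^ k"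
  obtains j where "j \<le> k" "card H = p ^ j"
  using card_subgroup_dvd[OF assms(2-4)] assms by (metis divides_primepow_nat)

text \<open>The set is a union of double cosets RxP. Each has order |R| |P| divided by the order of
  the intersection of R with xPx^-1. That intersection is a proper subgroup of the p-group R, so a
  factor p survives. This one count yields both the conjugacy of Sylow subgroups and
  \<open>sylow_in_normalizing\<close>.\<close>

lemma dvd_card_not_conjugate:
  assumes p: "Factorial_Ring.prime p"
    and R: "subgroup R G" "card R = p ^ k" and P: "subgroup P G" and L: "subgroup L G"
    and RL: "R \<subseteq> L" and PL: "P \<subseteq> L"
  shows "p * card P dvd card {x \<in> L. \<not> R \<subseteq> conjs x P}"
proof -
  define S where "S = {x \<in> L. \<not> R \<subseteq> conjs x P}"
  \<comment> \<open>The double coset RxP. The facts \<open>refl\<close>, \<open>sub\<close> and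
    \<open>sym\<close> below show that two such sets are equal or disjoint.\<close>
  define D where "D x = {r \<otimes> x \<otimes> h | r h. r \<in> R \<and> h \<in> P}" for x
  note c = subgroup.mem_carrier[OF R(1)] subgroup.mem_carrier[OF P] subgroup.mem_carrier[OF L]
  have Sc: "x \<in> carrier G" if "x \<in> S" for x using that c by (simp add: S_def)
  have refl: "x \<in> D x" if "x \<in> carrier G" for x
  proof -
    have "x = \<one> \<otimes> x \<otimes> \<one>" using that by simp
    then show ?thesis using subgroup_one[OF R(1)] subgroup_one[OF P] unfolding D_def by blast
  qed
  have sub: "D y \<subseteq> D x" if x: "x \<in> carrier G" and y: "y \<in> D x" for x y
  proof
    fix z assume "z \<in> D y"
    then obtain r h r' h' where rh: "r \<in> R" "h \<in> P" "y = r \<otimes> x \<otimes> h"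
      "r' \<in> R" "h' \<in> P" "z = r' \<otimes> y \<otimes> h'" using y unfolding D_def by blast
    then have "z = (r' \<otimes> r) \<otimes> x \<otimes> (h \<otimes> h')" using x c by (simp add: m_assoc)
    then show "z \<in> D x" using rh R(1) P unfolding D_def by (blast intro: subgroup.m_closed)
  qed
  have sym: "x \<in> D y" if x: "x \<in> carrier G" and y: "y \<in> D x" for x y
  proof -
    obtain r h where rh: "r \<in> R" "h \<in> P" "y = r \<otimes> x \<otimes> h" using y unfolding D_def by blast
    have "inv r \<otimes> y \<otimes> inv h = (inv r \<otimes> r) \<otimes> x \<otimes> (h \<otimes> inv h)"
      using rh x c by (simp only: m_assoc m_closed inv_closed)
    also have "\<dots> = x" using rh x c by simp
    finally have "x = inv r \<otimes> y \<otimes> inv h" by simp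
    moreover have "inv r \<in> R" "inv h \<in> P" using rh R(1) P by (simp_all add: subgroup.m_inv_closed)
    ultimately show ?thesis unfolding D_def by blast
  qed
  have Dc: "D x \<subseteq> carrier G" if "x \<in> carrier G" for x using that c unfolding D_def by auto
  \<comment> \<open>Replacing x by rxh turns xPx^-1 into its conjugate by r, and r normalizes R; so
    membership in S depends only on the double coset.\<close>
  have DS: "D x \<subseteq> S" if x: "x \<in> S" for x
  proof
    fix y assume "y \<in> D x"
    then obtain r h where rh: "r \<in> R" "h \<in> P" "y = r \<otimes> x \<otimes> h" unfolding D_def by blast
    have xL: "x \<in> L" and xc: "x \<in> carrier G" and nx: "\<not> R \<subseteq> conjs x P" using x Sc by (auto simp: S_def)
    have "y \<in> L" using rh xL L RL PL by (auto intro!: subgroup.m_closed)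
    moreover have "\<not> R \<subseteq> conjs y P"
    proof
      assume a: "R \<subseteq> conjs y P"
      have "conjs y P = conjs r (conjs x (conjs h P))"
        using rh xc c subgroup.subset[OF P] by (simp add: conjs_mult conjs_carrier)
      also have "conjs h P = P" using subset_normalizing[OF P] rh by (auto simp: normalizing_def)
      finally have "conjs (inv r) R \<subseteq> conjs (inv r) (conjs r (conjs x P))" using a conjs_mono by metis
      also have "\<dots> = conjs x P" using conjs_inv1 rh c xc conjs_carrier subgroup.subset[OF P] by metis
      also have "conjs (inv r) R = R"
        using subset_normalizing[OF R(1)] subgroup.m_inv_closed[OF R(1)] rh by (auto simp: normalizing_def)
      finally show False using nx by blast
    qed
    ultimately show "y \<in> S" by (simp add: S_def)
  qed
  have S_eq: "\<Union> (D ` S) = S" using DS refl Sc by blast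
  have dvd: "p * card P dvd card (D x)" if x: "x \<in> S" for x
  proof -
    have xc: "x \<in> carrier G" and nx: "\<not> R \<subseteq> conjs x P" using x Sc by (auto simp: S_def)
    have xP: "subgroup (conjs x P) G" using conjs_subgroup[OF xc P] .
    \<comment> \<open>Right translation by x carries the product of R and xPx^-1 onto RxP, so the
      product formula applies.\<close>
    have "D x = (\<lambda>z. z \<otimes> x) ` (R <#> conjs x P)"
    proof -
      have e: "r \<otimes> x \<otimes> h = r \<otimes> (x \<otimes> h \<otimes> inv x) \<otimes> x" if "r \<in> R" "h \<in> P" for r h
        using that c xc by (simp add: m_assoc)
      have "D x = {r \<otimes> (x \<otimes> h \<otimes> inv x) \<otimes> x | r h. r \<in> R \<and> h \<in> P}"
        unfolding D_def by (intro Collect_cong ex_cong1) (use e in auto)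
      then show ?thesis unfolding set_mult_def conjs_def by auto
    qed
    moreover have "inj_on (\<lambda>z. z \<otimes> x) (R <#> conjs x P)"
      using set_mult_subset_carrier[OF R(1) xP] xc by (intro inj_onI) (simp add: subset_iff)
    ultimately have "card (D x) = card (R <#> conjs x P)" by (simp add: card_image)
    then have eq: "card (D x) * card (R \<inter> conjs x P) = p ^ k * card P"
      using card_set_mult[OF R(1) xP] card_conjs[OF xc subgroup.subset[OF P]] R(2) by simp
    have si: "subgroup (R \<inter> conjs x P) G" using R(1) xP by (rule subgroups_Inter_pair)
    then obtain j where j: "j \<le> k" "card (R \<inter> conjs x P) = p ^ j"
      using p_subgroup_sub[OF p si R(1) _ R(2)] by blast
    have "j \<noteq> k"
    proof
      assume "j = k"
      then have "R \<inter> conjs x P = R" using subgroup_eqI[OF si R(1)] j R(2) by auto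
      then show False using nx by blast
    qed
    then have "j < k" using j by simp
    then have "p ^ k = p ^ j * (p ^ (k - j - 1) * p)"
      by (metis Suc_diff_Suc diff_Suc_eq_diff_pred le_add_diff_inverse less_imp_le mult.commute power_Suc power_add diff_Suc_1 diff_right_commute)
    then have "p ^ j * card (D x) = p ^ j * (p ^ (k - j - 1) * (p * card P))"
      using eq j by (simp add: ac_simps)
    then have "card (D x) = p ^ (k - j - 1) * (p * card P)"
      using prime_gt_0_nat[OF p] by simp
    then show ?thesis by simp
  qed
  have "p * card P dvd card (\<Union> (D ` S))"
  proof (rule dvd_partition)
    have "S \<subseteq> carrier G" using Sc by blast
    then show "finite (\<Union> (D ` S))" using S_eq finite_subset[OF _ fin] by simp
    show "\<forall>c\<in>D ` S. p * card P dvd card c" using dvd by blast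
    show "\<forall>c1\<in>D ` S. \<forall>c2\<in>D ` S. c1 \<noteq> c2 \<longrightarrow> c1 \<inter> c2 = {}"
    proof clarsimp
      fix x y assume xy: "x \<in> S" "y \<in> S" "D x \<noteq> D y"
      show "D x \<inter> D y = {}"
      proof (rule ccontr)
        assume "D x \<inter> D y \<noteq> {}"
        then obtain z where z: "z \<in> D x" "z \<in> D y" by blast
        then have "z \<in> carrier G" using Dc Sc xy by blast
        then have "D z = D x" "D z = D y" using z sub sym Sc xy by blast+
        then show False using xy by simp
      qed
    qed
  qed
  then show ?thesis using S_eq by (simp add: S_def)
qed

text \<open>P is a Sylow p-subgroup of L, both read as subsets of G. If p does not divide |L|, then
  P is the trivial subgroup.\<close>

definition sylow_in :: "nat \<Rightarrow> 'a set \<Rightarrow> 'a set \<Rightarrow> bool" where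
  "sylow_in p L P \<longleftrightarrow> subgroup P G \<and> P \<subseteq> L \<and> card P = p ^ multiplicity p (card L)"

lemma sylow_inD:
  assumes "sylow_in p L P"
  shows "subgroup P G" "P \<subseteq> L" "card P = p ^ multiplicity p (card L)"
  using assms by (auto simp: sylow_in_def)

lemma sylow_in_exists:
  assumes p: "Factorial_Ring.prime p" and L: "subgroup L G"
  obtains P where "sylow_in p L P"
proof -
  have gL: "group (G\<lparr>carrier := L\<rparr>)" using L by (rule subgroup_imp_group)
  have "card L \<noteq> 0" using subgroup_card_pos[OF L] by simp
  then obtain m where "card L = p ^ multiplicity p (card L) * m"
    by (metis dvd_def multiplicity_dvd)
  then obtain P where P: "subgroup P (G\<lparr>carrier := L\<rparr>)" "card P = p ^ multiplicity p (card L)"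
    using sylow_thm[OF p gL, of "multiplicity p (card L)" m] subgroup_finite[OF L]
    by (auto simp: order_def)
  then have "subgroup P G" "P \<subseteq> L"
    using incl_subgroup[OF L P(1)] subgroup.subset[OF P(1)] by auto
  then show ?thesis using that P by (simp add: sylow_in_def)
qed

lemma card_sylow_cofactor:
  assumes p: "Factorial_Ring.prime p" and L: "subgroup L G" and P: "sylow_in p L P"
  obtains m where "card L = card P * m" "\<not> p dvd m"
proof -
  have "card L \<noteq> 0" using subgroup_card_pos[OF L] by simp
  moreover have "\<not> is_unit p" using p not_prime_unit by blast
  ultimately obtain m where "card L = p ^ multiplicity p (card L) * m" "\<not> p dvd m"
    using multiplicity_decompose' by metis
  then show ?thesis using that sylow_inD(3)[OF P] by simp
qed

lemma sylow_inI:
  assumes "Factorial_Ring.prime p" "subgroup P G" "P \<subseteq> L" "card P = p ^ k" "card L = card P * m" "\<not> p dvd m"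
  shows "sylow_in p L P"
  using assms multiplicity_prime_power_mult by (simp add: sylow_in_def)

lemma sylow_nontrivial:
  assumes p: "Factorial_Ring.prime p" and L: "subgroup L G" and P: "sylow_in p L P" and d: "p dvd card L"
  shows "P \<noteq> {\<one>}"
proof
  assume "P = {\<one>}"
  then have "card P = 1" by simp
  then show False using card_sylow_cofactor[OF p L P] d by (metis mult_1)
qed

text \<open>If no conjugate of P contained R, the double coset count would run over all of L, and
  p|P| would divide |L| = |P| m with m prime to p.\<close>

lemma sylow_contains_conjugate:
  assumes p: "Factorial_Ring.prime p" and L: "subgroup L G" and P: "sylow_in p L P"
    and R: "subgroup R G" "R \<subseteq> L" "card R = p ^ k"
  obtains g where "g \<in> L" "R \<subseteq> conjs g P"
proof -
  obtain m where m: "card L = card P * m" "\<not> p dvd m" using card_sylow_cofactor[OF p L P] .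
  have "\<exists>g\<in>L. R \<subseteq> conjs g P"
  proof (rule ccontr)
    assume "\<not> ?thesis"
    then have "{x \<in> L. \<not> R \<subseteq> conjs x P} = L" by blast
    then have "p * card P dvd card P * m"
      using dvd_card_not_conjugate[OF p R(1,3) sylow_inD(1)[OF P] L R(2) sylow_inD(2)[OF P]] m by simp
    then have "p dvd m" using subgroup_card_pos[OF sylow_inD(1)[OF P]] by (simp add: mult.commute)
    then show False using m by simp
  qed
  then show ?thesis using that by blast
qed

lemma sylow_conjugate:
  assumes p: "Factorial_Ring.prime p" and L: "subgroup L G" and P: "sylow_in p L P" and R: "sylow_in p L R"
  obtains g where "g \<in> L" "conjs g P = R"
proof -
  obtain g where g: "g \<in> L" "R \<subseteq> conjs g P"
    using sylow_contains_conjugate[OF p L P sylow_inD[OF R]] .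
  have gc: "g \<in> carrier G" using g L subgroup.mem_carrier by metis
  have "card (conjs g P) = card R"
    using card_conjs[OF gc subgroup.subset[OF sylow_inD(1)[OF P]]] sylow_inD(3)[OF P] sylow_inD(3)[OF R] by simp
  then have "R = conjs g P"
    using subgroup_eqI[OF sylow_inD(1)[OF R] conjs_subgroup[OF gc sylow_inD(1)[OF P]] g(2)] by simp
  then show ?thesis using that g by blast
qed

lemma sylow_conjs:
  assumes "sylow_in p L P" "g \<in> carrier G" "conjs g P \<subseteq> L"
  shows "sylow_in p L (conjs g P)"
  using assms conjs_subgroup card_conjs[OF _ subgroup.subset] by (simp add: sylow_in_def)

text \<open>The conjugate gPg^-1 is again a Sylow subgroup of N, hence equals nPn^-1 with n in N;
  then n^-1 g normalizes P.\<close>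

lemma frattini_argument:
  assumes p: "Factorial_Ring.prime p" and N: "N \<lhd> G" and P: "sylow_in p N P" and g: "g \<in> carrier G"
  obtains n m where "n \<in> N" "m \<in> normalizing P" "g = n \<otimes> m"
proof -
  have Ns: "subgroup N G" using N by (rule normal_imp_subgroup)
  note Pc = subgroup.subset[OF sylow_inD(1)[OF P]]
  have "conjs g P \<subseteq> N" using conjs_mono[OF sylow_inD(2)[OF P], of g] normal_conjs[OF N g] by simp
  then have "sylow_in p N (conjs g P)" using sylow_conjs[OF P g] by simp
  then obtain n where n: "n \<in> N" "conjs n P = conjs g P" using sylow_conjugate[OF p Ns P] by blast
  have nc: "n \<in> carrier G" using n Ns subgroup.mem_carrier by metis
  have "conjs (inv n \<otimes> g) P = P" using n nc g Pc by (metis conjs_mult conjs_inv1 inv_closed)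
  then have "inv n \<otimes> g \<in> normalizing P" using nc g by (simp add: normalizing_def)
  moreover have "g = n \<otimes> (inv n \<otimes> g)" using nc g by (simp add: m_assoc[symmetric])
  ultimately show ?thesis using that n by blast
qed

text \<open>The index of P in L divides its index in K, which is prime to p.\<close>

lemma sylow_in_restrict:
  assumes p: "Factorial_Ring.prime p" and P: "sylow_in p K P" and K: "subgroup K G"
    and L: "subgroup L G" "P \<subseteq> L" "L \<subseteq> K"
  shows "sylow_in p L P"
proof -
  obtain m where m: "card K = card P * m" "\<not> p dvd m" using card_sylow_cofactor[OF p K P] .
  obtain l where l: "card L = card P * l"
    using card_subgroup_dvd[OF sylow_inD(1)[OF P] L(1,2)] by auto
  have "card P * l dvd card P * m" using card_subgroup_dvd[OF L(1) K L(3)] m l by simp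
  then have "l dvd m" using subgroup_card_pos[OF sylow_inD(1)[OF P]] by simp
  then have "\<not> p dvd l" using m(2) dvd_trans by blast
  then show ?thesis using sylow_inI[OF p sylow_inD(1)[OF P] L(2) sylow_inD(3)[OF P] l] by simp
qed

text \<open>In the double coset count with P = R and L = G, the elements counted are those outside
  N(R). So the indices of R in G and in N(R) are congruent modulo p, and the latter is prime to
  p.\<close>

lemma sylow_in_normalizing:
  assumes p: "Factorial_Ring.prime p" and R: "sylow_in p (normalizing R) R"
  shows "sylow_in p (carrier G) R"
proof -
  note Rs = sylow_inD(1)[OF R]
  have Ns: "subgroup (normalizing R) G" using subgroup_normalizing[OF subgroup.subset[OF Rs]] .
  obtain m where m: "card (normalizing R) = card R * m" "\<not> p dvd m" using card_sylow_cofactor[OF p Ns R] .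
  have "R \<subseteq> conjs x R \<longleftrightarrow> x \<in> normalizing R" if x: "x \<in> carrier G" for x
  proof
    assume "R \<subseteq> conjs x R"
    then have "R = conjs x R"
      using subgroup_eqI[OF Rs conjs_subgroup[OF x Rs]] card_conjs[OF x subgroup.subset[OF Rs]] by simp
    then show "x \<in> normalizing R" using x by (simp add: normalizing_def)
  qed (auto simp: normalizing_def)
  then have "{x \<in> carrier G. \<not> R \<subseteq> conjs x R} = carrier G - normalizing R" by blast
  then have "p * card R dvd card (carrier G - normalizing R)"
    using dvd_card_not_conjugate[OF p Rs sylow_inD(3)[OF R] Rs subgroup_self]
      subgroup.subset[OF Rs] by simp
  then obtain c where "card (carrier G - normalizing R) = p * card R * c" by (rule dvdE)
  then have c: "card (carrier G - normalizing R) = card R * (p * c)" by (simp add: ac_simps)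
  have "card (carrier G) = card (normalizing R) + card (carrier G - normalizing R)"
    using card_Diff_subset[OF subgroup_finite[OF Ns] normalizing_subset]
      card_mono[OF fin normalizing_subset] by simp
  then have eq: "card (carrier G) = card R * (m + p * c)" using c m by (simp add: algebra_simps)
  moreover have "\<not> p dvd m + p * c" using m by (metis dvd_add_left_iff dvd_triv_left)
  ultimately show ?thesis
    using sylow_inI[OF p Rs subgroup.subset[OF Rs] sylow_inD(3)[OF R]] by blast
qed

lemma maximal_subgroup_exists:
  assumes H: "subgroup H G" "H \<noteq> carrier G"
  obtains M where "maximal_subgroup M G" "H \<subseteq> M"
proof -
  define A where "A = {K. subgroup K G \<and> H \<subseteq> K \<and> K \<noteq> carrier G}"
  have "A \<subseteq> Pow (carrier G)" using subgroup.subset by (auto simp: A_def)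
  then have "finite A" using finite_subset finite_Pow_iff fin by metis
  moreover have "H \<in> A" using H by (simp add: A_def)
  ultimately obtain M where M: "M \<in> A" "H \<subseteq> M" "\<forall>K\<in>A. M \<subseteq> K \<longrightarrow> M = K"
    using finite_has_maximal2 by metis
  then have "maximal_subgroup M G" unfolding maximal_subgroup_def A_def by blast
  then show ?thesis using that M by blast
qed

end

section \<open>Nilpotent subgroups and transfer\<close>

lemma prime_power_if_unique_prime:
  fixes n :: nat
  assumes q: "Factorial_Ring.prime q" and "n \<noteq> 0"
    and "\<And>r. Factorial_Ring.prime r \<Longrightarrow> r dvd n \<Longrightarrow> r = q"
  obtains k where "n = q ^ k"
proof -
  have "\<not> is_unit q" using q not_prime_unit by blast
  then obtain m where m: "n = q ^ multiplicity q n * m" "\<not> q dvd m"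
    using multiplicity_decompose' assms(2) by metis
  have "m = 1"
  proof (rule ccontr)
    assume "m \<noteq> 1"
    then obtain r where r: "Factorial_Ring.prime r" "r dvd m" using prime_factor_nat by blast
    then have "r dvd n" using m(1) by (metis dvd_mult)
    then show False using assms(3) r m(2) by blast
  qed
  then show ?thesis using that m by simp
qed

lemma lower_central_subset:
  assumes "group H"
  shows "lower_central H n \<subseteq> carrier H"
proof (induction n)
  case (Suc n)
  interpret H: group H by fact
  show ?case using Suc unfolding lower_central.simps
    by (intro H.generate_incl) auto
qed simp

context finite_group
begin

section \<open>Subgroups of coprime order and normal Hall subgroups\<close>

lemma coprime_Int:
  assumes H: "subgroup H G" and K: "subgroup K G" and co: "coprime (card H) (card K)"
  shows "H \<inter> K = {\<one>}"
proof -
  have s: "subgroup (H \<inter> K) G" using H K by (rule subgroups_Inter_pair)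
  have "card (H \<inter> K) dvd card H" "card (H \<inter> K) dvd card K"
    using card_subgroup_dvd[OF s H] card_subgroup_dvd[OF s K] by auto
  then have "card (H \<inter> K) = 1" using co by (metis coprime_common_divisor_nat)
  then show ?thesis using subgroup_one[OF s] by (metis card_1_singletonE singletonD)
qed

lemma card_set_mult_coprime:
  assumes H: "subgroup H G" and K: "subgroup K G" and co: "coprime (card H) (card K)"
  shows "card (H <#> K) = card H * card K"
  using card_set_mult[OF H K] coprime_Int[OF H K co] by simp

lemma set_mult_subset:
  assumes "subgroup L G" "H \<subseteq> L" "K \<subseteq> L"
  shows "H <#> K \<subseteq> L"
  using assms unfolding set_mult_def by (auto intro: subgroup.m_closed)

text \<open>The commutator h k h^-1 k^-1 lies in H as well as in K.\<close>

lemma commute_if_normalizing: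
  assumes H: "subgroup H G" and K: "subgroup K G"
    and "H \<subseteq> normalizing K" "K \<subseteq> normalizing H" "H \<inter> K = {\<one>}" and h: "h \<in> H" and k: "k \<in> K"
  shows "h \<otimes> k = k \<otimes> h"
proof -
  have c: "h \<in> carrier G" "k \<in> carrier G" using h k H K subgroup.mem_carrier by metis+
  have "h \<otimes> k \<otimes> inv h \<in> K" using assms normalizingD by blast
  then have 1: "h \<otimes> k \<otimes> inv h \<otimes> inv k \<in> K" using k K by (simp add: subgroup.m_closed subgroup.m_inv_closed)
  have "k \<otimes> inv h \<otimes> inv k \<in> H" using assms normalizingD subgroup.m_inv_closed[OF H h] by blast
  then have "h \<otimes> (k \<otimes> inv h \<otimes> inv k) \<in> H" using h H by (simp add: subgroup.m_closed)
  then have "h \<otimes> k \<otimes> inv h \<otimes> inv k \<in> H" using c by (simp add: m_assoc)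
  then have "h \<otimes> k \<otimes> inv h \<otimes> inv k = \<one>" using 1 assms(5) by blast
  then have "h \<otimes> k \<otimes> inv (k \<otimes> h) = \<one>" using c by (simp add: m_assoc inv_mult_group)
  then show ?thesis using c by (metis inv_equality inv_inv inv_closed m_closed)
qed

text \<open>A normal Hall subgroup is characteristic. For a conjugate K' of K, the index s of K in
  K'K divides |K| by the product formula and divides m because K'K lies in T; hence s = 1 and K'
  lies in K.\<close>

lemma normal_hall_subgroup:
  assumes T: "T \<lhd> G" and K: "subgroup K G" "K \<subseteq> T" "T \<subseteq> normalizing K"
    and card: "card T = card K * m" "coprime m (card K)"
  shows "K \<lhd> G"
  unfolding normal_iff_normalizing
proof (intro conjI subsetI K(1))
  fix g assume g: "g \<in> carrier G"
  have Ts: "subgroup T G" using T by (rule normal_imp_subgroup)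
  define K' where "K' = conjs g K"
  have K': "subgroup K' G" unfolding K'_def using g K(1) by (rule conjs_subgroup)
  have K'T: "K' \<subseteq> T" using conjs_mono[OF K(2)] normal_conjs[OF T g] by (auto simp: K'_def)
  have J: "subgroup (K' <#> K) G" using subgroup_set_mult[OF K' K(1)] K'T K(3) by blast
  have JT: "K' <#> K \<subseteq> T" using set_mult_subset[OF Ts K'T K(2)] .
  have pos: "card K > 0" using subgroup_card_pos K by blast
  obtain s where s: "card (K' <#> K) = card K * s"
    using card_subgroup_dvd[OF K(1) J] subset_set_mult(2)[OF K' K(1)] by auto
  have "card K' = card K" using card_conjs[OF g subgroup.subset[OF K(1)]] by (simp add: K'_def)
  then have "card K * s * card (K' \<inter> K) = card K * card K"
    using card_set_mult[OF K' K(1)] s by simp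
  then have "s * card (K' \<inter> K) = card K" using pos by simp
  then have "s dvd card K" by (metis dvd_triv_left)
  moreover have "s dvd m" using card_subgroup_dvd[OF J Ts JT] s card(1) pos by simp
  ultimately have "s = 1" using card(2) by (metis coprime_common_divisor_nat)
  then have "K = K' <#> K" using subgroup_eqI[OF K(1) J subset_set_mult(2)[OF K' K(1)]] s by simp
  then have "conjs g K \<subseteq> K" using subset_set_mult(1)[OF K' K(1)] by (simp add: K'_def)
  then show "g \<in> normalizing K" using normalizingI[OF K(1) g] by simp
qed

text \<open>The last term of the lower central series of \<open>L\<close> not contained in \<open>D\<close> normalizes \<open>D\<close>.\<close>

lemma nilpotent_normalizer_grows:
  assumes L: "subgroup L G" and nil: "nilpotent_group (G\<lparr>carrier := L\<rparr>)"
    and D: "subgroup D G" "D \<subseteq> L" "D \<noteq> L"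
  obtains x where "x \<in> L" "x \<notin> D" "x \<in> normalizing D"
proof -
  let ?L = "G\<lparr>carrier := L\<rparr>"
  have gL: "group ?L" using L by (rule subgroup_imp_group)
  obtain n where "lower_central ?L n = {\<one>}" using nil by (auto simp: nilpotent_group_def)
  then have "lower_central ?L n \<subseteq> D" using subgroup_one[OF D(1)] by simp
  moreover have "\<not> lower_central ?L 0 \<subseteq> D" using D by auto
  ultimately obtain m where m: "\<not> lower_central ?L m \<subseteq> D" "lower_central ?L (Suc m) \<subseteq> D"
    using ex_least_nat_less[of "\<lambda>n. lower_central ?L n \<subseteq> D" n] by blast
  then obtain x where x: "x \<in> lower_central ?L m" "x \<notin> D" by blast
  have xL: "x \<in> L" using lower_central_subset[OF gL, of m] x by auto
  have xc: "x \<in> carrier G" using xL L subgroup.mem_carrier by metis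
  have "x \<otimes> d \<otimes> inv x \<in> D" if d: "d \<in> D" for d
  proof -
    have dL: "d \<in> L" and dc: "d \<in> carrier G" using d D subgroup.mem_carrier by fastforce+
    \<comment> \<open>The commutator [x, d] is a generator of the next term, which lies in D; hence
      so does x d x^-1 = [x, d] d.\<close>
    have "x \<otimes> d \<otimes> inv x \<otimes> inv d \<in> lower_central ?L (Suc m)"
      unfolding lower_central.simps
    proof (rule generate.incl, clarify, intro exI conjI)
      show "x \<otimes> d \<otimes> inv x \<otimes> inv d
          = x \<otimes>\<^bsub>?L\<^esub> d \<otimes>\<^bsub>?L\<^esub> inv\<^bsub>?L\<^esub> x \<otimes>\<^bsub>?L\<^esub> inv\<^bsub>?L\<^esub> d"
        using m_inv_consistent[OF L] xL dL by simp
    qed (use x dL in auto)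
    then have "x \<otimes> d \<otimes> inv x \<otimes> inv d \<in> D" using m by blast
    then have "x \<otimes> d \<otimes> inv x \<otimes> inv d \<otimes> d \<in> D" using d D(1) by (simp add: subgroup.m_closed)
    then show ?thesis using xc dc by (simp add: m_assoc)
  qed
  then have "conjs x D \<subseteq> D" by (auto simp: conjs_def)
  then have "x \<in> normalizing D" using normalizingI[OF D(1) xc] by simp
  then show ?thesis using that xL x by blast
qed

text \<open>Normalizers grow, so if N, the normalizer of P in L, were proper, some x in L outside N
  would normalize N. But P is normal in N and hence its only Sylow p-subgroup, so x would normalize
  P as well.\<close>

lemma nilpotent_sylow_normal:
  assumes p: "Factorial_Ring.prime p" and L: "subgroup L G" and nil: "nilpotent_group (G\<lparr>carrier := L\<rparr>)"
    and P: "sylow_in p L P"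
  shows "L \<subseteq> normalizing P"
proof (rule ccontr)
  assume a: "\<not> L \<subseteq> normalizing P"
  note Ps = sylow_inD(1)[OF P] and Pc = subgroup.subset[OF sylow_inD(1)[OF P]]
  define N where "N = L \<inter> normalizing P"
  have N: "subgroup N G" unfolding N_def using L subgroup_normalizing[OF Pc] by (rule subgroups_Inter_pair)
  obtain x where x: "x \<in> L" "x \<notin> N" "x \<in> normalizing N"
    using nilpotent_normalizer_grows[OF L nil N] a by (auto simp: N_def)
  have xc: "x \<in> carrier G" using x L subgroup.mem_carrier by metis
  have PN: "P \<subseteq> N" using subset_normalizing[OF Ps] sylow_inD(2)[OF P] by (auto simp: N_def)
  have PsN: "sylow_in p N P" using sylow_in_restrict[OF p P L N PN] by (auto simp: N_def)
  have "conjs x P \<subseteq> N" using conjs_mono[OF PN, of x] x(3) by (auto simp: normalizing_def)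
  then have "sylow_in p N (conjs x P)" using sylow_conjs[OF PsN xc] by simp
  then obtain n where n: "n \<in> N" "conjs n P = conjs x P" using sylow_conjugate[OF p N PsN] by blast
  then have "conjs x P = P" by (auto simp: N_def normalizing_def)
  then show False using x xc by (auto simp: N_def normalizing_def)
qed

lemma normal_sylow_contains:
  assumes p: "Factorial_Ring.prime p" and L: "subgroup L G" and P: "sylow_in p L P" "L \<subseteq> normalizing P"
    and R: "subgroup R G" "R \<subseteq> L" "card R = p ^ k"
  shows "R \<subseteq> P"
proof -
  obtain g where "g \<in> L" "R \<subseteq> conjs g P" using sylow_contains_conjugate[OF p L P(1) R] .
  then show ?thesis using P(2) by (auto simp: normalizing_def)
qed

text \<open>R is the intersection of N with the Sylow p-subgroup P of L, and L normalizes
  both.\<close>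

lemma nilpotent_sylow_of_normal:
  assumes p: "Factorial_Ring.prime p" and L: "subgroup L G" and nil: "nilpotent_group (G\<lparr>carrier := L\<rparr>)"
    and N: "subgroup N G" "N \<subseteq> L" "L \<subseteq> normalizing N" and R: "sylow_in p N R"
  shows "L \<subseteq> normalizing R"
proof -
  obtain P where P: "sylow_in p L P" using sylow_in_exists[OF p L] .
  have LP: "L \<subseteq> normalizing P" using nilpotent_sylow_normal[OF p L nil P] .
  note Ps = sylow_inD(1)[OF P] and Rs = sylow_inD(1)[OF R]
  have RP: "R \<subseteq> P"
    using normal_sylow_contains[OF p L P LP Rs _ sylow_inD(3)[OF R]] sylow_inD(2)[OF R] N(2) by blast
  have NP: "subgroup (N \<inter> P) G" using N(1) Ps by (rule subgroups_Inter_pair)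
  obtain j where j: "card (N \<inter> P) = p ^ j"
    using p_subgroup_sub[OF p NP Ps _ sylow_inD(3)[OF P]] by blast
  obtain g where g: "g \<in> N" "N \<inter> P \<subseteq> conjs g R"
    using sylow_contains_conjugate[OF p N(1) R NP _ j] by blast
  have gc: "g \<in> carrier G" using g N subgroup.mem_carrier by metis
  have "card (N \<inter> P) \<le> card R"
    using card_mono[OF subgroup_finite[OF conjs_subgroup[OF gc Rs]] g(2)]
      card_conjs[OF gc subgroup.subset[OF Rs]] by simp
  then have "R = N \<inter> P" using subgroup_eqI[OF Rs NP] RP sylow_inD(2)[OF R] by blast
  then show ?thesis using normalizing_Int[OF N(1) Ps] N(3) LP by blast
qed

text \<open>Take K maximal among the normal subgroups of L of order prime to q. Multiplying K by the
  normal Sylow r-subgroup for a prime r other than q cannot enlarge it, so K absorbs all these Sylow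
  subgroups and its index is a power of q.\<close>

lemma nilpotent_normal_complement:
  assumes q: "Factorial_Ring.prime q" and L: "subgroup L G" and nil: "nilpotent_group (G\<lparr>carrier := L\<rparr>)"
  obtains K a where "subgroup K G" "K \<subseteq> L" "L \<subseteq> normalizing K" "coprime (card K) q"
    "card L = card K * q ^ a"
proof -
  define A where "A = {K. subgroup K G \<and> K \<subseteq> L \<and> L \<subseteq> normalizing K \<and> coprime (card K) q}"
  have "A \<subseteq> Pow L" by (auto simp: A_def)
  then have "finite A" using subgroup_finite[OF L] finite_subset finite_Pow_iff by metis
  moreover have "{\<one>} \<in> A"
    using triv_subgroup subgroup_one[OF L] one_is_normal subgroup.subset[OF L]
    by (auto simp: A_def normal_iff_normalizing)
  ultimately obtain K where K: "K \<in> A" "\<forall>J\<in>A. K \<subseteq> J \<longrightarrow> K = J"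
    using finite_has_maximal[of A] by blast
  then have Ks: "subgroup K G" "K \<subseteq> L" "L \<subseteq> normalizing K" "coprime (card K) q" by (auto simp: A_def)
  obtain m where m: "card L = card K * m" using card_subgroup_dvd[OF Ks(1) L Ks(2)] by auto
  have "m \<noteq> 0" using m subgroup_card_pos[OF L] by auto
  moreover have "r = q" if r: "Factorial_Ring.prime r" "r dvd m" for r
  proof (rule ccontr)
    assume "r \<noteq> q"
    obtain R where R: "sylow_in r L R" using sylow_in_exists[OF r(1) L] .
    note Rs = sylow_inD(1)[OF R]
    have LR: "L \<subseteq> normalizing R" using nilpotent_sylow_normal[OF r(1) L nil R] .
    have J: "subgroup (K <#> R) G" using subgroup_set_mult[OF Ks(1) Rs] Ks(2) LR by blast
    have "coprime (card R) q"
      using \<open>r \<noteq> q\<close> r(1) q sylow_inD(3)[OF R] by (simp add: primes_coprime)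
    then have "coprime (card K * card R) q" using Ks(4) by simp
    moreover have "card (K <#> R) dvd card K * card R"
      using card_set_mult[OF Ks(1) Rs] by (metis dvd_triv_left)
    ultimately have "coprime (card (K <#> R)) q" using coprime_divisors[OF _ dvd_refl] by blast
    moreover have "L \<subseteq> normalizing (K <#> R)"
      using normalizing_set_mult[OF Ks(1) Rs J] Ks(3) LR by blast
    ultimately have "K <#> R \<in> A"
      using J set_mult_subset[OF L Ks(2) sylow_inD(2)[OF R]] by (simp add: A_def)
    then have "R \<subseteq> K" using K(2) subset_set_mult[OF Ks(1) Rs] by blast
    \<comment> \<open>|R| is the full r-part of |L| and divides |K|, so nothing of r is left for
      m.\<close>
    then obtain t where t: "card K = card R * t" using card_subgroup_dvd[OF Rs Ks(1)] by auto
    obtain l where l: "card L = card R * l" "\<not> r dvd l" using card_sylow_cofactor[OF r(1) L R] .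
    have "card R * l = card R * (t * m)" using l m t by (metis mult.assoc)
    then have "l = t * m" using subgroup_card_pos[OF Rs] by (simp only: nat_mult_eq_cancel1)
    then show False using l r by simp
  qed
  ultimately obtain a where "m = q ^ a" using prime_power_if_unique_prime[OF q] by blast
  then show ?thesis using that Ks m by blast
qed


section \<open>Transfer into a central subgroup\<close>

text \<open>This is the transfer homomorphism from G to Z. On a central subgroup of index n it is
  the n-th power map.\<close>

lemma central_transfer:
  assumes Z: "subgroup Z G" and central: "\<And>z g. z \<in> Z \<Longrightarrow> g \<in> carrier G \<Longrightarrow> z \<otimes> g = g \<otimes> z"
    and card: "card (carrier G) = card Z * n"
  obtains \<tau> where "\<tau> \<in> hom G (G\<lparr>carrier := Z\<rparr>)" "\<And>z. z \<in> Z \<Longrightarrow> \<tau> z = z [^] n"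
proof -
  let ?Z = "G\<lparr>carrier := Z\<rparr>"
  have c: "\<And>z. z \<in> Z \<Longrightarrow> z \<in> carrier G" using Z subgroup.mem_carrier by metis
  interpret Z: comm_group ?Z
    by (rule group.group_comm_groupI[OF subgroup_imp_group[OF Z]]) (simp add: central c)
  have Zsub: "Z \<subseteq> carrier G" using subgroup.subset[OF Z] .
  define C where "C = rcosets Z"
  define t where "t C = (SOME x. x \<in> C)" for C :: "'a set"
  define f where "f g c = t c \<otimes> g \<otimes> inv t (c #> g)" for g c
  define \<tau> where "\<tau> g = finprod ?Z (f g) C" for g
  have Csub: "c \<subseteq> carrier G" if "c \<in> C" for c
    using that subgroup.rcosets_carrier[OF Z is_group] by (simp add: C_def)
  have tC: "t c \<in> c" if "c \<in> C" for c
  proof -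
    have "c \<noteq> {}" using subgroup.rcosets_non_empty[OF Z] that by (auto simp: C_def)
    then show ?thesis unfolding t_def by (rule some_in_eq[THEN iffD2])
  qed
  have tc: "t c \<in> carrier G" if "c \<in> C" for c using tC Csub that by blast
  have Crep: "c = Z #> t c" if "c \<in> C" for c
  proof -
    obtain x where x: "x \<in> carrier G" "c = Z #> x" using \<open>c \<in> C\<close> unfolding C_def RCOSETS_def by blast
    then show ?thesis using repr_independence[OF _ x(1) Z] tC[OF that] by simp
  qed
  have Cmult: "c #> g = Z #> (t c \<otimes> g)" if "c \<in> C" "g \<in> carrier G" for c g
    using Crep[OF that(1)] coset_mult_assoc[OF Zsub tc[OF that(1)] that(2)] by simp
  have CmC: "c #> g \<in> C" if "c \<in> C" "g \<in> carrier G" for c g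
    using Cmult[OF that] tc that rcosetsI[OF Zsub] by (simp add: C_def)
  have fZ: "f g c \<in> Z" if cg: "c \<in> C" "g \<in> carrier G" for g c
  proof -
    have m: "t (c #> g) \<in> carrier G" "t c \<otimes> g \<in> carrier G" using tc CmC cg by auto
    have "t (c #> g) \<in> Z #> (t c \<otimes> g)" using tC[OF CmC[OF cg]] Cmult[OF cg] by simp
    then obtain z where z: "z \<in> Z" "t (c #> g) = z \<otimes> (t c \<otimes> g)" unfolding r_coset_def by blast
    have "w \<otimes> inv (z \<otimes> w) = inv z" if "w \<in> carrier G" for w
      using that c[OF z(1)] by (simp add: inv_mult_group m_assoc[symmetric])
    from this[OF m(2)] have "f g c = inv z" unfolding f_def z(2) .
    then show ?thesis using z Z by (simp add: subgroup.m_inv_closed)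
  qed
  have finC: "finite C" unfolding C_def using rcosets_finite[OF _ Zsub] fin
    by (simp add: RCOSETS_def)
  have bij: "bij_betw (\<lambda>c. c #> g) C C" if g: "g \<in> carrier G" for g
    by (rule bij_betw_byWitness[where f' = "\<lambda>c. c #> inv g"])
      (use g CmC Csub in \<open>auto simp: coset_mult_assoc\<close>)
  \<comment> \<open>Cocycle identity: inserting t(cg)^-1 t(cg) between g and h splits the factor of
    gh.\<close>
  have fmult: "f (g \<otimes> h) c = f g c \<otimes> f h (c #> g)"
    if "c \<in> C" "g \<in> carrier G" "h \<in> carrier G" for g h c
  proof -
    have eq: "c #> (g \<otimes> h) = (c #> g) #> h" using coset_mult_assoc Csub that by simp
    have m: "t c \<in> carrier G" "t (c #> g) \<in> carrier G" "t ((c #> g) #> h) \<in> carrier G"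
      using that tc CmC by auto
    have "inv t (c #> g) \<otimes> (t (c #> g) \<otimes> (h \<otimes> inv t ((c #> g) #> h))) = h \<otimes> inv t ((c #> g) #> h)"
      using m that by (simp add: m_assoc[symmetric])
    then show ?thesis unfolding f_def eq using m that by (simp add: m_assoc)
  qed
  have "\<tau> \<in> hom G ?Z"
  proof (rule homI)
    show "\<tau> g \<in> carrier ?Z" if "g \<in> carrier G" for g
      unfolding \<tau>_def using fZ that by (intro Z.finprod_closed) auto
    show "\<tau> (g \<otimes> h) = \<tau> g \<otimes>\<^bsub>?Z\<^esub> \<tau> h" if g: "g \<in> carrier G" and h: "h \<in> carrier G" for g h
    proof -
      have "\<tau> (g \<otimes> h) = finprod ?Z (\<lambda>c. f g c \<otimes>\<^bsub>?Z\<^esub> f h (c #> g)) C"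
        unfolding \<tau>_def using fmult fZ CmC g h Z by (intro Z.finprod_cong') (auto intro: subgroup.m_closed)
      also have "\<dots> = finprod ?Z (f g) C \<otimes>\<^bsub>?Z\<^esub> finprod ?Z (\<lambda>c. f h (c #> g)) C"
        using fZ CmC g h by (intro Z.finprod_multf) auto
      \<comment> \<open>Right multiplication by g permutes the cosets, so the shifted product is
        again the transfer of h.\<close>
      also have "finprod ?Z (\<lambda>c. f h (c #> g)) C = finprod ?Z (f h) ((\<lambda>c. c #> g) ` C)"
        using bij[OF g] fZ h CmC g by (subst Z.finprod_reindex) (auto simp: bij_betw_def)
      also have "(\<lambda>c. c #> g) ` C = C" using bij[OF g] by (simp add: bij_betw_def)
      finally show ?thesis by (simp add: \<tau>_def)
    qed
  qed
  moreover have "\<tau> z = z [^] n" if z: "z \<in> Z" for z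
  proof -
    \<comment> \<open>An element z of Z fixes every coset, so each of the n factors is t(c) z
      t(c)^-1 = z.\<close>
    have "f z c = z" if cC: "c \<in> C" for c
    proof -
      have "c #> z = Z #> (z \<otimes> t c)" using Cmult[OF cC c[OF z]] central[OF z tc[OF cC]] by simp
      also have "\<dots> = c"
        using coset_mult_assoc[OF Zsub c[OF z] tc[OF cC]] coset_join2[OF c[OF z] Z z] Crep[OF cC] by simp
      finally show ?thesis unfolding f_def using central[OF z tc[OF cC]] tc[OF cC] c[OF z]
        by (metis inv_solve_right m_closed)
    qed
    then have "\<tau> z = finprod ?Z (\<lambda>_. z) C" unfolding \<tau>_def using z by (intro Z.finprod_cong') auto
    also have "\<dots> = z [^]\<^bsub>?Z\<^esub> card C" using z by (simp add: Z.finprod_const)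
    also have "card C = n"
      using lagrange[OF Z] card subgroup_card_pos[OF Z] by (simp add: order_def C_def)
    finally show ?thesis by (simp add: nat_pow_consistent[symmetric])
  qed
  ultimately show ?thesis using that by blast
qed

text \<open>K is the kernel of the transfer. An element z common to K and Z satisfies z^n = 1 and
  z^|Z| = 1 with coprime exponents, so K meets Z trivially and |K| is at most n.\<close>

lemma central_hall_complement:
  assumes Z: "subgroup Z G" and central: "\<And>z g. z \<in> Z \<Longrightarrow> g \<in> carrier G \<Longrightarrow> z \<otimes> g = g \<otimes> z"
    and card: "card (carrier G) = card Z * n" and co: "coprime n (card Z)"
  obtains K where "K \<lhd> G" "card K = n"
proof -
  let ?Z = "G\<lparr>carrier := Z\<rparr>"
  obtain \<tau> where \<tau>: "\<tau> \<in> hom G ?Z" "\<And>z. z \<in> Z \<Longrightarrow> \<tau> z = z [^] n"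
    using central_transfer[OF Z central card] by blast
  interpret Z: group ?Z using Z by (rule subgroup_imp_group)
  interpret \<tau>: group_hom G ?Z \<tau> by unfold_locales (rule \<tau>(1))
  define K where "K = kernel G ?Z \<tau>"
  have nK: "K \<lhd> G" unfolding K_def by (rule \<tau>.normal_kernel)
  have K: "subgroup K G" using nK by (rule normal_imp_subgroup)
  have "K \<inter> Z \<subseteq> {\<one>}"
  proof
    fix z assume z: "z \<in> K \<inter> Z"
    then have zc: "z \<in> carrier G" using K subgroup.mem_carrier by fastforce
    have "z [^] n = \<one>" using z \<tau>(2) by (auto simp: K_def kernel_def)
    moreover have "z [^] card Z = \<one>"
      using Z.pow_order_eq_1[of z] z by (simp add: order_def nat_pow_consistent[symmetric])
    ultimately have "ord z dvd n" "ord z dvd card Z" using pow_eq_id zc by auto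
    then have "ord z = 1" using co by (metis coprime_common_divisor_nat)
    then show "z \<in> {\<one>}" using zc ord_eq_1 by simp
  qed
  then have "K \<inter> Z = {\<one>}" using subgroup_one[OF K] subgroup_one[OF Z] by blast
  then have "card (K <#> Z) = card K * card Z" using card_set_mult[OF K Z] by simp
  moreover have "card (K <#> Z) \<le> card (carrier G)"
    by (rule card_mono[OF fin set_mult_subset_carrier[OF K Z]])
  ultimately have "card K \<le> n" using card subgroup_card_pos[OF Z] by simp
  \<comment> \<open>The transfer embeds G/K into Z. This bounds the index of K by |Z| and gives the
    reverse inequality.\<close>
  have "card (rcosets K) \<le> card Z"
  proof (rule card_inj_on_le)
    show "inj_on (\<lambda>c. the_elem (\<tau> ` c)) (rcosets K)"
      using \<tau>.FactGroup_inj_on by (simp add: FactGroup_def K_def)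
    show "(\<lambda>c. the_elem (\<tau> ` c)) ` (rcosets K) \<subseteq> Z"
      using \<tau>.FactGroup_the_elem_mem by (auto simp: FactGroup_def K_def)
    show "finite Z" using Z by (rule subgroup_finite)
  qed
  then have "card (rcosets K) * card K \<le> card Z * card K" by simp
  moreover have "card (rcosets K) * card K = card Z * n"
    using lagrange[OF K] card by (simp add: order_def)
  ultimately have "n \<le> card K" using subgroup_card_pos[OF Z] by simp
  then show ?thesis using that nK \<open>card K \<le> n\<close> by simp
qed

end

section \<open>The minimal counterexample\<close>

text \<open>Views E as a group of its own and translates the normality of the complement back into a
  statement about normalizers in G.\<close>

lemma (in finite_group) central_hall_complement_in:
  assumes E: "subgroup E G" and Z: "subgroup Z G" "Z \<subseteq> E"
    and central: "\<And>z g. z \<in> Z \<Longrightarrow> g \<in> E \<Longrightarrow> z \<otimes> g = g \<otimes> z"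
    and card: "card E = card Z * n" and co: "coprime n (card Z)"
  obtains K where "subgroup K G" "K \<subseteq> E" "E \<subseteq> normalizing K" "card K = n"
proof -
  let ?E = "G\<lparr>carrier := E\<rparr>"
  interpret E: finite_group ?E
    using subgroup_imp_group[OF E] subgroup_finite[OF E]
    by (simp add: finite_group_def finite_group_axioms_def)
  obtain K where K: "K \<lhd> ?E" "card K = n"
    using E.central_hall_complement[OF subgroup_incl[OF Z(1) E Z(2)], of n] central card co by auto
  then have "subgroup K ?E" by (simp add: normal_imp_subgroup)
  then have Ks: "subgroup K G" "K \<subseteq> E"
    using incl_subgroup[OF E] subgroup.subset by fastforce+
  have "x \<in> normalizing K" if x: "x \<in> E" for x
  proof (rule normalizingI[OF Ks(1)])
    show "x \<in> carrier G" using x E subgroup.mem_carrier by metis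
    have "x \<otimes> h \<otimes> inv x \<in> K" if "h \<in> K" for h
      using E.normal_invE(2)[OF K(1), of x h] x that m_inv_consistent[OF E x] by simp
    then show "conjs x K \<subseteq> K" by (auto simp: conjs_def)
  qed
  then show ?thesis using that Ks K(2) by blast
qed

context finite_group
begin

text \<open>For normal \<open>N\<close>, these express that \<open>G Mod N\<close> is \<open>q\<close>-nilpotent or \<open>q\<close>-closed. Phrasing them inside
  \<open>G\<close> keeps the induction over quotients within one type.\<close>

definition rel_q_nilpotent :: "nat \<Rightarrow> 'a set \<Rightarrow> bool" where
  "rel_q_nilpotent q N \<longleftrightarrow> (\<exists>T m k. T \<lhd> G \<and> N \<subseteq> T \<and> card T = card N * m \<and> coprime m q
      \<and> card (carrier G) = card T * q ^ k)"

definition rel_q_closed :: "nat \<Rightarrow> 'a set \<Rightarrow> bool" where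
  "rel_q_closed q N \<longleftrightarrow> (\<exists>S m k. S \<lhd> G \<and> N \<subseteq> S \<and> card S = card N * q ^ k \<and> coprime m q
      \<and> card (carrier G) = card S * m)"

definition nonnilpotent_maximal_normal :: bool where
  "nonnilpotent_maximal_normal \<longleftrightarrow>
    (\<forall>M. maximal_subgroup M G \<longrightarrow> nilpotent_group (G\<lparr>carrier := M\<rparr>) \<or> M \<lhd> G)"

section \<open>Maximal subgroups, normal subgroups and centralizers\<close>

lemma maximal_subgroupD:
  assumes "maximal_subgroup M G"
  shows "subgroup M G" "M \<noteq> carrier G"
    and "subgroup H G \<Longrightarrow> M \<subseteq> H \<Longrightarrow> H = M \<or> H = carrier G"
  using assms by (auto simp: maximal_subgroup_def)

lemma normal_if_normalizing: "subgroup N G \<Longrightarrow> carrier G \<subseteq> normalizing N \<Longrightarrow> N \<lhd> G"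
  by (simp add: normal_iff_normalizing)

lemma normal_Int:
  assumes "N \<lhd> G" "K \<lhd> G"
  shows "N \<inter> K \<lhd> G"
  using assms normalizing_Int[of N K] subgroups_Inter_pair unfolding normal_iff_normalizing by blast

lemma centralizer_normal:
  assumes U: "U \<lhd> G"
  shows "{g \<in> carrier G. \<forall>u\<in>U. g \<otimes> u = u \<otimes> g} \<lhd> G" (is "?C \<lhd> G")
proof -
  have Us: "subgroup U G" using U by (rule normal_imp_subgroup)
  have uc: "\<And>u. u \<in> U \<Longrightarrow> u \<in> carrier G" using Us subgroup.mem_carrier by metis
  have C: "subgroup ?C G"
  proof (rule subgroupI)
    show "?C \<noteq> {}" using uc by force
    show "inv a \<in> ?C" if "a \<in> ?C" for a
    proof -
      have a: "a \<in> carrier G" "\<And>u. u \<in> U \<Longrightarrow> a \<otimes> u = u \<otimes> a" using that by auto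
      have "inv a \<otimes> u = u \<otimes> inv a" if u: "u \<in> U" for u
      proof -
        have "u = inv a \<otimes> (u \<otimes> a)"
          using a(1) a(2)[OF u, symmetric] uc[OF u] by (simp add: m_assoc[symmetric])
        then have "u \<otimes> inv a = inv a \<otimes> u"
          using a(1) uc[OF u] by (metis inv_closed inv_solve_right' m_assoc m_closed)
        then show ?thesis by simp
      qed
      then show ?thesis using a by simp
    qed
    show "a \<otimes> b \<in> ?C" if "a \<in> ?C" "b \<in> ?C" for a b
    proof -
      have ab: "a \<in> carrier G" "b \<in> carrier G" "\<And>u. u \<in> U \<Longrightarrow> a \<otimes> u = u \<otimes> a"
        "\<And>u. u \<in> U \<Longrightarrow> b \<otimes> u = u \<otimes> b" using that by auto
      have "a \<otimes> b \<otimes> u = u \<otimes> (a \<otimes> b)" if u: "u \<in> U" for u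
      proof -
        have "a \<otimes> b \<otimes> u = a \<otimes> (u \<otimes> b)" using ab u uc[OF u] by (simp add: m_assoc)
        also have "\<dots> = a \<otimes> u \<otimes> b" using ab(1,2) uc[OF u] by (simp add: m_assoc)
        also have "\<dots> = u \<otimes> (a \<otimes> b)" using ab(1,2) ab(3)[OF u] uc[OF u] by (simp add: m_assoc)
        finally show ?thesis .
      qed
      then show ?thesis using ab by simp
    qed
  qed auto
  moreover have "g \<in> normalizing ?C" if g: "g \<in> carrier G" for g
  proof (rule normalizingI[OF C g], rule subsetI)
    fix y assume "y \<in> conjs g ?C"
    then obtain x where x: "x \<in> ?C" "y = g \<otimes> x \<otimes> inv g" unfolding conjs_def by blast
    then have xc: "x \<in> carrier G" by simp
    have "y \<otimes> u = u \<otimes> y" if u: "u \<in> U" for u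
    proof -
      \<comment> \<open>Writing u as gvg^-1 with v in U shows that y = gxg^-1 commutes with u
        because x commutes with v.\<close>
      define v where "v = inv g \<otimes> u \<otimes> g"
      have v: "v \<in> U" using normal.inv_op_closed1[OF U g u] by (simp add: v_def)
      have "u = g \<otimes> v \<otimes> inv g" using g uc[OF u] by (simp add: v_def m_assoc inv_solve_left)
          (simp add: m_assoc[symmetric])
      then show ?thesis
        using conj_hom[OF g uc[OF v] xc] conj_hom[OF g xc uc[OF v]] x v by auto
    qed
    then show "y \<in> ?C" using x g xc by simp
  qed
  ultimately show ?thesis unfolding normal_iff_normalizing by blast
qed

end

text \<open>G violates the conclusion for q, while its quotients by nontrivial normal subgroups
  satisfy it. The relative notions at the trivial subgroup are those for G itself.\<close>

locale minimal_counterexample = finite_group +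
  fixes q :: nat
  assumes q: "Factorial_Ring.prime q"
    and maximal: "nonnilpotent_maximal_normal"
    and not_nilpotent: "\<not> rel_q_nilpotent q {\<one>}"
    and not_closed: "\<not> rel_q_closed q {\<one>}"
    and quotients: "\<And>N. N \<lhd> G \<Longrightarrow> N \<noteq> {\<one>} \<Longrightarrow> rel_q_nilpotent q N \<or> rel_q_closed q N"
begin

section \<open>Normalizers of Sylow subgroups and normal subgroups of order prime to q\<close>

lemma nilpotent_if_not_normal:
  "maximal_subgroup M G \<Longrightarrow> \<not> M \<lhd> G \<Longrightarrow> nilpotent_group (G\<lparr>carrier := M\<rparr>)"
  using maximal by (auto simp: nonnilpotent_maximal_normal_def)

lemma no_normal_q_complement:
  assumes "N \<lhd> G" "coprime (card N) q" "card (carrier G) = card N * q ^ k"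
  shows False
  using not_nilpotent assms subgroup_one[OF normal_imp_subgroup[OF assms(1)]]
  unfolding rel_q_nilpotent_def by fastforce

lemma no_normal_q_sylow:
  assumes "S \<lhd> G" "card S = q ^ k" "coprime m q" "card (carrier G) = card S * m"
  shows False
  using not_closed assms subgroup_one[OF normal_imp_subgroup[OF assms(1)]]
  unfolding rel_q_closed_def by fastforce

text \<open>Let L be maximal above N(R). If L were normal, Frattini would give G = L N(R) = L. So L
  is nilpotent, hence normalizes R, and L = N(R).\<close>

lemma sylow_normalizer_maximal:
  assumes r: "Factorial_Ring.prime r" and R: "sylow_in r (carrier G) R" and nn: "\<not> R \<lhd> G"
  shows "maximal_subgroup (normalizing R) G" "\<not> normalizing R \<lhd> G"
    "nilpotent_group (G\<lparr>carrier := normalizing R\<rparr>)"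
proof -
  note Rs = sylow_inD(1)[OF R]
  have N: "subgroup (normalizing R) G" using subgroup_normalizing[OF subgroup.subset[OF Rs]] .
  have "normalizing R \<noteq> carrier G" using nn Rs by (auto simp: normal_iff_normalizing)
  then obtain L where L: "maximal_subgroup L G" "normalizing R \<subseteq> L" using maximal_subgroup_exists[OF N] by blast
  note Ls = maximal_subgroupD(1)[OF L(1)]
  have RL: "R \<subseteq> L" using subset_normalizing[OF Rs] L(2) by blast
  have RsL: "sylow_in r L R"
    using sylow_in_restrict[OF r R subgroup_self Ls RL subgroup.subset[OF Ls]] .
  have nL: "\<not> L \<lhd> G"
  proof
    assume "L \<lhd> G"
    then have "g \<in> L" if "g \<in> carrier G" for g
      using frattini_argument[OF r _ RsL that] L(2) subgroup.m_closed[OF Ls] by (metis subsetD)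
    then show False using maximal_subgroupD(2)[OF L(1)] subgroup.subset[OF Ls] by blast
  qed
  have nil: "nilpotent_group (G\<lparr>carrier := L\<rparr>)" using nilpotent_if_not_normal[OF L(1) nL] .
  have "L = normalizing R" using L(2) nilpotent_sylow_normal[OF r Ls nil RsL] by blast
  then show "maximal_subgroup (normalizing R) G" "\<not> normalizing R \<lhd> G"
    "nilpotent_group (G\<lparr>carrier := normalizing R\<rparr>)" using L(1) nL nil by auto
qed

lemma normal_coprime_trivial:
  assumes H: "H \<lhd> G" and co: "coprime (card H) q"
  shows "H = {\<one>}"
proof (rule ccontr)
  assume ne: "H \<noteq> {\<one>}"
  have Hs: "subgroup H G" using H by (rule normal_imp_subgroup)
  \<comment> \<open>A normal q-complement of G/H would pull back to one of G, because |H| is prime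
    to q.\<close>
  have "\<not> rel_q_nilpotent q H"
  proof
    assume "rel_q_nilpotent q H"
    then obtain T m k where "T \<lhd> G" "card T = card H * m" "coprime m q" "card (carrier G) = card T * q ^ k"
      unfolding rel_q_nilpotent_def by blast
    then show False using no_normal_q_complement[of T k] co by simp
  qed
  then have "rel_q_closed q H" using quotients[OF H ne] by blast
  then obtain S m k where S: "S \<lhd> G" "H \<subseteq> S" "card S = card H * q ^ k" "coprime m q"
    "card (carrier G) = card S * m" unfolding rel_q_closed_def by blast
  have Ss: "subgroup S G" using S(1) by (rule normal_imp_subgroup)
  have nd: "\<not> q dvd n" if "coprime n q" for n using that q by (metis coprime_common_divisor_nat dvd_refl not_prime_1)
  obtain Q where Q: "sylow_in q S Q" using sylow_in_exists[OF q Ss] .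
  note Qs = sylow_inD(1)[OF Q]
  have cQ: "card Q = q ^ k"
    using sylow_inD(3)[OF Q] multiplicity_prime_power_mult[OF q nd[OF co], of k] S(3) by (simp add: mult.commute)
  have cG: "card (carrier G) = card Q * (card H * m)" using S cQ by simp
  have coHm: "coprime (card H * m) q" using co S(4) by simp
  have QG: "sylow_in q (carrier G) Q"
    by (rule sylow_inI[OF q Qs subgroup.subset[OF Qs] cQ cG nd[OF coHm]])
  have nQ: "\<not> Q \<lhd> G" using no_normal_q_sylow[OF _ cQ coHm cG] by blast
  define M where "M = normalizing Q"
  have M: "maximal_subgroup M G" "nilpotent_group (G\<lparr>carrier := M\<rparr>)"
    using sylow_normalizer_maximal[OF q QG nQ] by (auto simp: M_def)
  note Ms = maximal_subgroupD(1)[OF M(1)]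
  have QM: "Q \<subseteq> M" unfolding M_def by (rule subset_normalizing[OF Qs])
  have coQ: "coprime n (card Q)" if "coprime n q" for n using that cQ by simp
  obtain K a where K: "subgroup K G" "K \<subseteq> M" "M \<subseteq> normalizing K" "coprime (card K) q"
    "card M = card K * q ^ a" using nilpotent_normal_complement[OF q Ms M(2)] by blast
  \<comment> \<open>H and Q have coprime orders whose product is |S|; the same count gives M = KQ
    below.\<close>
  have S_eq: "H <#> Q = S"
    using card_seteq[OF subgroup_finite[OF Ss] set_mult_subset[OF Ss S(2) sylow_inD(2)[OF Q]]]
      card_set_mult_coprime[OF Hs Qs coQ[OF co]] S(3) cQ by simp
  have M_eq: "K <#> Q = M"
  proof -
    have "sylow_in q M Q" using sylow_in_restrict[OF q QG subgroup_self Ms QM subgroup.subset[OF Ms]] .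
    then have "card Q = q ^ a"
      using multiplicity_prime_power_mult[OF q nd[OF K(4)], of a] K(5) by (simp add: sylow_in_def mult.commute)
    then show ?thesis
      using card_seteq[OF subgroup_finite[OF Ms] set_mult_subset[OF Ms K(2) QM]]
        card_set_mult_coprime[OF K(1) Qs coQ[OF K(4)]] K(5) by simp
  qed
  \<comment> \<open>Frattini gives G = SM. As S = HQ and Q lies in M, this is G = HM.\<close>
  have HM: "\<exists>h\<in>H. \<exists>x\<in>M. g = h \<otimes> x" if g: "g \<in> carrier G" for g
  proof -
    obtain s n where sn: "s \<in> S" "n \<in> M" "g = s \<otimes> n"
      using frattini_argument[OF q S(1) Q g] unfolding M_def by blast
    then obtain h x where hx: "h \<in> H" "x \<in> Q" "s = h \<otimes> x" using S_eq unfolding set_mult_def by blast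
    then have "g = h \<otimes> (x \<otimes> n)"
      using sn subgroup.mem_carrier[OF Hs] subgroup.mem_carrier[OF Ms] QM by (simp add: m_assoc subset_iff)
    moreover have "x \<otimes> n \<in> M" using hx sn QM Ms by (auto intro: subgroup.m_closed)
    ultimately show ?thesis using hx by blast
  qed
  have KH: "K \<subseteq> normalizing H" using normalizing_normal[OF H] subgroup.subset[OF K(1)] by simp
  \<comment> \<open>J will be the normal q-complement: M normalizes K and H, and H lies in J, so G =
    HM normalizes J.\<close>
  define J where "J = K <#> H"
  have J: "subgroup J G" unfolding J_def by (rule subgroup_set_mult[OF K(1) Hs KH])
  have sub: "K \<subseteq> J" "H \<subseteq> J" unfolding J_def by (rule subset_set_mult[OF K(1) Hs])+
  have MJ: "M \<subseteq> normalizing J"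
    using normalizing_set_mult[OF K(1) Hs J[unfolded J_def]] K(3) normalizing_normal[OF H]
      subgroup.subset[OF Ms] by (auto simp: J_def)
  have HJ: "H \<subseteq> normalizing J" using sub subset_normalizing[OF J] by blast
  have NJ: "subgroup (normalizing J) G" using subgroup_normalizing[OF subgroup.subset[OF J]] .
  have "g \<in> normalizing J" if "g \<in> carrier G" for g
    using HM[OF that] MJ HJ subgroup.m_closed[OF NJ] by (metis subsetD)
  then have nJ: "J \<lhd> G" using normal_if_normalizing[OF J] by blast
  have "card J dvd card K * card H"
    unfolding J_def using card_set_mult[OF K(1) Hs] by (metis dvd_triv_left)
  moreover have "coprime (card K * card H) q" using K(4) co by simp
  ultimately have coJ: "coprime (card J) q" using coprime_divisors[OF _ dvd_refl] by blast
  \<comment> \<open>G = HM = HKQ, and HK lies in J.\<close>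
  have "carrier G \<subseteq> J <#> Q"
  proof
    fix g assume "g \<in> carrier G"
    then obtain h x where hx: "h \<in> H" "x \<in> M" "g = h \<otimes> x" using HM by blast
    then obtain k y where ky: "k \<in> K" "y \<in> Q" "x = k \<otimes> y" using M_eq unfolding set_mult_def by blast
    have "g = (h \<otimes> k) \<otimes> y"
      using hx ky subgroup.mem_carrier[OF Hs] subgroup.mem_carrier[OF K(1)] subgroup.mem_carrier[OF Qs]
      by (simp add: m_assoc)
    moreover have "h \<otimes> k \<in> J" using hx ky sub J by (auto intro: subgroup.m_closed)
    ultimately show "g \<in> J <#> Q" using ky set_mult_memI by simp
  qed
  then have "carrier G = J <#> Q" using set_mult_subset_carrier[OF J Qs] by blast
  then have "card (carrier G) = card J * q ^ k"
    using card_set_mult_coprime[OF J Qs coQ[OF coJ]] cQ by simp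
  then show False using no_normal_q_complement[OF nJ coJ] by blast
qed

lemma normal_prime_power_coprime_trivial:
  assumes "Factorial_Ring.prime r" "r \<noteq> q" "N \<lhd> G" "card N = r ^ k"
  shows "N = {\<one>}"
  using normal_coprime_trivial[OF assms(3)] assms q by (simp add: primes_coprime)

end

section \<open>Normal q-subgroups\<close>

context minimal_counterexample
begin

lemma normal_q_subgroup_trivial:
  assumes U: "U \<lhd> G" and cU: "card U = q ^ k"
  shows "U = {\<one>}"
proof (rule ccontr)
  assume ne: "U \<noteq> {\<one>}"
  have Us: "subgroup U G" using U by (rule normal_imp_subgroup)
  \<comment> \<open>The preimage of a normal Sylow q-subgroup of G/U is one of G, since U is itself
    a q-group.\<close>
  have "\<not> rel_q_closed q U"
  proof
    assume "rel_q_closed q U"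
    then obtain S m j where "S \<lhd> G" "card S = card U * q ^ j" "coprime m q" "card (carrier G) = card S * m"
      unfolding rel_q_closed_def by blast
    then show False using no_normal_q_sylow[of S "k + j" m] cU by (simp add: power_add)
  qed
  then have "rel_q_nilpotent q U" using quotients[OF U ne] by blast
  then obtain T m j where T: "T \<lhd> G" "U \<subseteq> T" "card T = card U * m" "coprime m q"
    "card (carrier G) = card T * q ^ j" unfolding rel_q_nilpotent_def by blast
  have Ts: "subgroup T G" using T(1) by (rule normal_imp_subgroup)
  define C where "C = {g \<in> carrier G. \<forall>u\<in>U. g \<otimes> u = u \<otimes> g}"
  have C: "C \<lhd> G" unfolding C_def by (rule centralizer_normal[OF U])
  have Cs: "subgroup C G" using C by (rule normal_imp_subgroup)
  have nU: "normalizing U = carrier G" using normalizing_normal[OF U] .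
  \<comment> \<open>Sylow subgroups for other primes centralize U; this is what later places them in
    E.\<close>
  have RC: "R \<subseteq> C" if r: "Factorial_Ring.prime r" "r \<noteq> q" and R: "sylow_in r (carrier G) R" for r R
  proof (cases "R \<lhd> G")
    case True
    then have "R = {\<one>}"
      using normal_prime_power_coprime_trivial[OF r True sylow_inD(3)[OF R]] by simp
    then show ?thesis using subgroup_one[OF Cs] by simp
  next
    case False
    note Rs = sylow_inD(1)[OF R]
    define L where "L = normalizing R"
    have L: "maximal_subgroup L G" "nilpotent_group (G\<lparr>carrier := L\<rparr>)"
      using sylow_normalizer_maximal[OF r(1) R False] by (auto simp: L_def)
    note Ls = maximal_subgroupD(1)[OF L(1)]
    \<comment> \<open>Otherwise G = LU by maximality. With Q the Sylow q-subgroup of the nilpotent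
      L, the q-group QU is normalized by L and U and has index prime to q, so G would be
      q-closed.\<close>
    have "U \<subseteq> L"
    proof (rule ccontr)
      assume nUL: "\<not> U \<subseteq> L"
      have LU: "subgroup (L <#> U) G"
        using subgroup_set_mult[OF Ls Us] nU subgroup.subset[OF Ls] by simp
      have LUG: "L <#> U = carrier G"
        using maximal_subgroupD(3)[OF L(1) LU] subset_set_mult[OF Ls Us] nUL by blast
      obtain Q where Q: "sylow_in q L Q" using sylow_in_exists[OF q Ls] .
      note Qs = sylow_inD(1)[OF Q]
      have LQ: "L \<subseteq> normalizing Q" using nilpotent_sylow_normal[OF q Ls L(2) Q] .
      define S where "S = Q <#> U"
      have S: "subgroup S G" unfolding S_def
        using subgroup_set_mult[OF Qs Us] nU subgroup.subset[OF Qs] by simp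
      have NS: "subgroup (normalizing S) G" using subgroup_normalizing[OF subgroup.subset[OF S]] .
      have "L \<subseteq> normalizing S"
        using normalizing_set_mult[OF Qs Us S[unfolded S_def]] LQ nU subgroup.subset[OF Ls]
        by (auto simp: S_def)
      moreover have "U \<subseteq> normalizing S"
        using subset_set_mult(2)[OF Qs Us] subset_normalizing[OF S] by (auto simp: S_def)
      ultimately have "carrier G \<subseteq> normalizing S" using set_mult_subset[OF NS] LUG by blast
      then have nS: "S \<lhd> G" using normal_if_normalizing[OF S] by blast
      \<comment> \<open>The intersection of L and U is a q-subgroup of L, so the normal Sylow
        q-subgroup Q contains it.\<close>
      have QU: "Q \<inter> U = L \<inter> U"
      proof -
        have s: "subgroup (L \<inter> U) G" using Ls Us by (rule subgroups_Inter_pair)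
        obtain i where "card (L \<inter> U) = q ^ i"
          using p_subgroup_sub[OF q s Us _ cU] by blast
        then have "L \<inter> U \<subseteq> Q" using normal_sylow_contains[OF q Ls Q LQ s] by blast
        then show ?thesis using sylow_inD(2)[OF Q] by blast
      qed
      have SQ: "card S * card (L \<inter> U) = card Q * card U"
        using card_set_mult[OF Qs Us] QU by (simp add: S_def)
      then have "card S dvd q ^ (multiplicity q (card L) + k)"
        using sylow_inD(3)[OF Q] cU by (metis dvd_triv_left power_add)
      then obtain i where cS: "card S = q ^ i" using divides_primepow_nat[OF q] by blast
      obtain l where l: "card L = card Q * l" "\<not> q dvd l" using card_sylow_cofactor[OF q Ls Q] .
      have "card (carrier G) * card (L \<inter> U) = card S * l * card (L \<inter> U)"
        using card_set_mult[OF Ls Us] LUG SQ l(1) by (metis mult.commute mult.left_commute)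
      moreover have "card (L \<inter> U) > 0"
        using subgroup_card_pos[OF subgroups_Inter_pair[OF Ls Us]] .
      ultimately have "card (carrier G) = card S * l" by simp
      moreover have "coprime l q" using prime_imp_coprime_nat[OF q l(2)] by (simp add: coprime_commute)
      ultimately show False using no_normal_q_sylow[OF nS cS] by blast
    qed
    \<comment> \<open>U and R normalize each other and have coprime orders, hence commute
      elementwise.\<close>
    have "U \<inter> R = {\<one>}"
      by (rule coprime_Int[OF Us Rs])
        (use cU sylow_inD(3)[OF R] r q in \<open>simp add: primes_coprime\<close>)
    then have "u \<otimes> x = x \<otimes> u" if "u \<in> U" "x \<in> R" for u x
      using commute_if_normalizing[OF Us Rs] \<open>U \<subseteq> L\<close> nU subgroup.subset[OF Rs] that
      by (simp add: L_def)
    then show ?thesis using subgroup.subset[OF Rs] by (auto simp: C_def)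
  qed
  \<comment> \<open>Z is central in E because E centralizes U. Its index n will turn out to divide
    m, which makes Z a central Hall subgroup and lets the transfer produce a complement K.\<close>
  define E where "E = T \<inter> C"
  define Z where "Z = U \<inter> C"
  have E: "E \<lhd> G" unfolding E_def using T(1) C by (rule normal_Int)
  have Es: "subgroup E G" using E by (rule normal_imp_subgroup)
  have Zs: "subgroup Z G" unfolding Z_def using Us Cs by (rule subgroups_Inter_pair)
  have ZE: "Z \<subseteq> E" using T(2) by (auto simp: Z_def E_def)
  have central: "z \<otimes> g = g \<otimes> z" if "z \<in> Z" "g \<in> E" for z g
    using that by (auto simp: Z_def E_def C_def)
  obtain i where cZ: "card Z = q ^ i"
    using p_subgroup_sub[OF q Zs Us _ cU] by (auto simp: Z_def)
  obtain n where n: "card E = card Z * n" using card_subgroup_dvd[OF Zs Es ZE] by auto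
  \<comment> \<open>Compares EU with T: |EU| = n|U| divides |T| = m|U|, so n divides m.\<close>
  have "E \<inter> U = Z" using T(2) by (auto simp: E_def Z_def)
  then have "card (E <#> U) * card Z = n * card U * card Z"
    using card_set_mult[OF Es Us] n by (simp only: ac_simps)
  then have "card (E <#> U) = n * card U" using subgroup_card_pos[OF Zs] by simp
  moreover have "subgroup (E <#> U) G"
    using subgroup_set_mult[OF Es Us] nU subgroup.subset[OF Es] by simp
  ultimately have "n * card U dvd m * card U"
    using card_subgroup_dvd[OF _ Ts set_mult_subset[OF Ts _ T(2)], of E] T(3) by (simp add: E_def mult.commute)
  then have "n dvd m" using subgroup_card_pos[OF Us] by simp
  then have con: "coprime n q" using T(4) coprime_divisors[OF _ dvd_refl] by blast
  then have coZ: "coprime n (card Z)" using cZ by simp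
  obtain K where K: "subgroup K G" "K \<subseteq> E" "E \<subseteq> normalizing K" "card K = n"
    using central_hall_complement_in[OF Es Zs ZE central n coZ] by blast
  \<comment> \<open>K is a normal Hall subgroup of the normal subgroup E, so it is normal in G. Its
    order is prime to q, so it is trivial, which leaves E a q-group.\<close>
  have "K \<lhd> G"
    using normal_hall_subgroup[OF E K(1-3), of "card Z"] n K(4) coZ by (simp add: mult.commute coprime_commute)
  then have "K = {\<one>}" using normal_coprime_trivial con K(4) by blast
  then have cE: "card E = q ^ i" using n cZ K(4) by simp
  \<comment> \<open>T has q-power index, so for r other than q a Sylow r-subgroup of T is one of G.
    It centralizes U, so it lies in the q-group E and is trivial. Hence G itself is a q-group, which
    is q-closed.\<close>
  have "r = q" if r: "Factorial_Ring.prime r" "r dvd card (carrier G)" for r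
  proof (rule ccontr)
    assume rq: "r \<noteq> q"
    obtain R where R: "sylow_in r T R" using sylow_in_exists[OF r(1) Ts] .
    note Rs = sylow_inD(1)[OF R]
    obtain t where t: "card T = card R * t" "\<not> r dvd t" using card_sylow_cofactor[OF r(1) Ts R] .
    have "\<not> r dvd t * q ^ j"
      using t(2) r(1) q rq by (metis prime_dvd_mult_iff prime_dvd_power primes_dvd_imp_eq)
    then have RG: "sylow_in r (carrier G) R"
      using sylow_inI[OF r(1) Rs subgroup.subset[OF Rs] sylow_inD(3)[OF R], of "t * q ^ j"] t(1) T(5) by simp
    have "R \<subseteq> E" using RC[OF r(1) rq RG] sylow_inD(2)[OF R] by (simp add: E_def)
    then have "card R dvd q ^ i" using card_subgroup_dvd[OF Rs Es] cE by simp
    moreover have "coprime (card R) (q ^ i)"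
      using sylow_inD(3)[OF R] r(1) q rq by (simp add: primes_coprime)
    ultimately have "card R = 1" by (metis coprime_common_divisor_nat dvd_refl)
    then show False using card_sylow_cofactor[OF r(1) subgroup_self RG] r(2) by (metis mult_1)
  qed
  then obtain a where a: "card (carrier G) = q ^ a"
    using prime_power_if_unique_prime[OF q] subgroup_card_pos[OF subgroup_self] by auto
  show False using no_normal_q_sylow[OF normal_self a, of 1] by simp
qed

lemma normal_prime_power_trivial:
  assumes "Factorial_Ring.prime r" "N \<lhd> G" "card N = r ^ k"
  shows "N = {\<one>}"
  using normal_prime_power_coprime_trivial[OF assms(1) _ assms(2,3)] normal_q_subgroup_trivial[OF assms(2)] assms(3)
  by blast

section \<open>Non-normal maximal subgroups as Hall subgroups\<close>

lemma carrier_nontrivial: "card (carrier G) \<noteq> 1"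
proof
  assume "card (carrier G) = 1"
  then show False using no_normal_q_sylow[OF normal_self, of 0 1] by simp
qed

text \<open>L is nilpotent, so it lies in N(R). G has no nontrivial normal r-subgroup, so N(R) is
  proper and equals L by maximality. Thus R is a Sylow subgroup of its own normalizer, hence of
  G.\<close>

lemma sylow_of_nonnormal_maximal:
  assumes L: "maximal_subgroup L G" "\<not> L \<lhd> G"
    and r: "Factorial_Ring.prime r" "r dvd card L" and R: "sylow_in r L R"
  shows "normalizing R = L" "sylow_in r (carrier G) R"
proof -
  note Ls = maximal_subgroupD(1)[OF L(1)] and Rs = sylow_inD(1)[OF R]
  have LR: "L \<subseteq> normalizing R" using nilpotent_sylow_normal[OF r(1) Ls nilpotent_if_not_normal[OF L] R] .
  have "normalizing R \<noteq> carrier G"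
  proof
    assume "normalizing R = carrier G"
    then have "R \<lhd> G" using normal_if_normalizing[OF Rs] by simp
    then have "R = {\<one>}" using normal_prime_power_trivial[OF r(1) _ sylow_inD(3)[OF R]] by simp
    then show False using sylow_nontrivial[OF r(1) Ls R r(2)] by simp
  qed
  then show eq: "normalizing R = L"
    using maximal_subgroupD(3)[OF L(1) subgroup_normalizing[OF subgroup.subset[OF Rs]] LR] by blast
  then show "sylow_in r (carrier G) R" using sylow_in_normalizing[OF r(1)] R by simp
qed

text \<open>A Sylow r-subgroup of L is one of G, so |L| already contains the whole r-part of
  |G|.\<close>

lemma nonnormal_maximal_hall:
  assumes L: "maximal_subgroup L G" "\<not> L \<lhd> G"
    and r: "Factorial_Ring.prime r" "r dvd card L" and m: "card (carrier G) = card L * m"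
  shows "\<not> r dvd m"
proof -
  note Ls = maximal_subgroupD(1)[OF L(1)]
  obtain R where R: "sylow_in r L R" using sylow_in_exists[OF r(1) Ls] .
  have RG: "sylow_in r (carrier G) R" using sylow_of_nonnormal_maximal[OF L r R] by simp
  obtain a where a: "card (carrier G) = card R * a" "\<not> r dvd a"
    using card_sylow_cofactor[OF r(1) subgroup_self RG] .
  obtain b where b: "card L = card R * b" using card_sylow_cofactor[OF r(1) Ls R] .
  have "card R * a = card R * (b * m)" using a b m by (metis mult.assoc)
  then have "a = b * m" using subgroup_card_pos[OF sylow_inD(1)[OF R]] by (simp only: nat_mult_eq_cancel1)
  then show ?thesis using a(2) by (metis dvd_mult)
qed

text \<open>The normalizer of a Sylow r-subgroup serves as L.\<close>

lemma nonnormal_maximal_of_prime: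
  assumes r: "Factorial_Ring.prime r" "r dvd card (carrier G)"
  obtains L where "maximal_subgroup L G" "\<not> L \<lhd> G" "r dvd card L"
proof -
  obtain R where R: "sylow_in r (carrier G) R" using sylow_in_exists[OF r(1) subgroup_self] .
  note Rs = sylow_inD(1)[OF R]
  have ne: "R \<noteq> {\<one>}" using sylow_nontrivial[OF r(1) subgroup_self R r(2)] .
  then have "\<not> R \<lhd> G" using normal_prime_power_trivial[OF r(1) _ sylow_inD(3)[OF R]] by blast
  note L = sylow_normalizer_maximal[OF r(1) R this]
  have "card R \<noteq> 1" using ne subgroup_one[OF Rs] by (metis card_1_singletonE singletonD)
  then have "r dvd card R"
    using sylow_inD(3)[OF R] by (cases "multiplicity r (card (carrier G))") auto
  then have "r dvd card (normalizing R)"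
    using card_subgroup_dvd[OF Rs maximal_subgroupD(1)[OF L(1)] subset_normalizing[OF Rs]] dvd_trans by blast
  then show ?thesis using that L by blast
qed

text \<open>Conjugation by g maps N(P) into N(gPg^-1). Applied in both directions, the inequality
  shows that conjugate Sylow subgroups have normalizers of equal order.\<close>

lemma card_normalizing_conjs:
  assumes g: "g \<in> carrier G" and P: "P \<subseteq> carrier G"
  shows "card (normalizing P) \<le> card (normalizing (conjs g P))"
proof -
  have "conjs g (normalizing P) \<subseteq> normalizing (conjs g P)"
  proof
    fix y assume "y \<in> conjs g (normalizing P)"
    then obtain x where x: "x \<in> normalizing P" "y = g \<otimes> x \<otimes> inv g" unfolding conjs_def by blast
    then have xc: "x \<in> carrier G" "conjs x P = P" by (auto simp: normalizing_def)
    have "y \<otimes> g = g \<otimes> x" using x g xc by (simp add: m_assoc)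
    then have "conjs y (conjs g P) = conjs g P"
      using conjs_mult[of y g P] conjs_mult[of g x P] x g xc P by simp
    then show "y \<in> normalizing (conjs g P)" using x xc g by (simp add: normalizing_def)
  qed
  then have "card (conjs g (normalizing P)) \<le> card (normalizing (conjs g P))"
    by (rule card_mono[OF finite_subset[OF normalizing_subset fin]])
  then show ?thesis using card_conjs[OF g normalizing_subset] by simp
qed

text \<open>If a prime p divides both orders, L and M are normalizers of Sylow p-subgroups of G, and
  these are conjugate.\<close>

lemma nonnormal_maximals_coprime_or_equal_card:
  assumes L: "maximal_subgroup L G" "\<not> L \<lhd> G" and M: "maximal_subgroup M G" "\<not> M \<lhd> G"
  shows "coprime (card L) (card M) \<or> card L = card M"
proof (rule disjCI)
  assume "card L \<noteq> card M"
  show "coprime (card L) (card M)"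
  proof (rule ccontr)
    assume "\<not> coprime (card L) (card M)"
    then have "gcd (card L) (card M) \<noteq> 1" by (simp add: coprime_iff_gcd_eq_1)
    then obtain p where "Factorial_Ring.prime p" "p dvd gcd (card L) (card M)"
      using prime_factor_nat by blast
    then have p: "Factorial_Ring.prime p" "p dvd card L" "p dvd card M" by simp_all
    obtain P where P: "sylow_in p L P" using sylow_in_exists[OF p(1) maximal_subgroupD(1)[OF L(1)]] .
    obtain R where R: "sylow_in p M R" using sylow_in_exists[OF p(1) maximal_subgroupD(1)[OF M(1)]] .
    note P' = sylow_of_nonnormal_maximal[OF L p(1,2) P]
    note R' = sylow_of_nonnormal_maximal[OF M p(1,3) R]
    have "card (normalizing A) \<le> card (normalizing B)"
      if A: "sylow_in p (carrier G) A" and B: "sylow_in p (carrier G) B" for A B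
    proof -
      obtain g where "g \<in> carrier G" "conjs g A = B"
        using sylow_conjugate[OF p(1) subgroup_self A B] .
      then show ?thesis using card_normalizing_conjs sylow_inD(2)[OF A] by blast
    qed
    from this[OF P'(2) R'(2)] this[OF R'(2) P'(2)] show False
      using P'(1) R'(1) \<open>card L \<noteq> card M\<close> by simp
  qed
qed

text \<open>Start from any L and choose a prime s dividing its index. Since L is a Hall subgroup, s
  does not divide |L|, so an M with order divisible by s differs from L in order.\<close>

lemma two_nonnormal_maximals:
  obtains L M where "maximal_subgroup L G" "\<not> L \<lhd> G" "maximal_subgroup M G" "\<not> M \<lhd> G"
    "coprime (card L) (card M)" "card L \<noteq> 1" "card M \<noteq> 1"
proof -
  obtain r where r: "Factorial_Ring.prime r" "r dvd card (carrier G)"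
    using carrier_nontrivial prime_factor_nat by blast
  obtain L where L: "maximal_subgroup L G" "\<not> L \<lhd> G" "r dvd card L"
    using nonnormal_maximal_of_prime[OF r] .
  note Ls = maximal_subgroupD(1)[OF L(1)]
  obtain m where m: "card (carrier G) = card L * m" using card_subgroup_dvd_carrier[OF Ls] by (rule dvdE)
  have "m \<noteq> 1"
    using m maximal_subgroupD(2)[OF L(1)] card_subset_eq[OF fin subgroup.subset[OF Ls]] by auto
  then obtain s where s: "Factorial_Ring.prime s" "s dvd m" using prime_factor_nat by blast
  then have "s dvd card (carrier G)" using m by simp
  then obtain M where M: "maximal_subgroup M G" "\<not> M \<lhd> G" "s dvd card M"
    using nonnormal_maximal_of_prime[OF s(1)] by blast
  have "\<not> s dvd card L" using nonnormal_maximal_hall[OF L(1,2) s(1) _ m] s(2) by blast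
  then have "coprime (card L) (card M)"
    using nonnormal_maximals_coprime_or_equal_card[OF L(1,2) M(1,2)] M(3) by auto
  moreover have "card L \<noteq> 1" "card M \<noteq> 1" using L(3) M(3) r s by auto
  ultimately show ?thesis using that L M by blast
qed

section \<open>Simplicity\<close>

text \<open>No non-normal maximal L contains N, so G = LN and the index of N divides |L|. Two such L
  of coprime orders force index 1.\<close>

lemma simple:
  assumes N: "N \<lhd> G" "N \<noteq> {\<one>}"
  shows "N = carrier G"
proof -
  have Ns: "subgroup N G" using N(1) by (rule normal_imp_subgroup)
  obtain i where i: "card (carrier G) = card N * i" using card_subgroup_dvd_carrier[OF Ns] by (rule dvdE)
  have idvd: "i dvd card L" if L: "maximal_subgroup L G" "\<not> L \<lhd> G" for L
  proof -
    note Ls = maximal_subgroupD(1)[OF L(1)]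
    \<comment> \<open>If N lay in L, the nilpotent L would normalize a Sylow subgroup R of N.
      Frattini writes G as N N(R), which is N(R) as N lies in L, and R would be a nontrivial normal
      subgroup of prime power order.\<close>
    have "\<not> N \<subseteq> L"
    proof
      assume NL: "N \<subseteq> L"
      have "card N \<noteq> 1" using N subgroup_one[OF Ns] by (metis card_1_singletonE singletonD)
      then obtain p where p: "Factorial_Ring.prime p" "p dvd card N" using prime_factor_nat by blast
      obtain R where R: "sylow_in p N R" using sylow_in_exists[OF p(1) Ns] .
      note Rs = sylow_inD(1)[OF R]
      have LR: "L \<subseteq> normalizing R"
        using nilpotent_sylow_of_normal[OF p(1) Ls nilpotent_if_not_normal[OF L] Ns NL _ R]
          normalizing_normal[OF N(1)] subgroup.subset[OF Ls] by simp
      have NR: "subgroup (normalizing R) G" using subgroup_normalizing[OF subgroup.subset[OF Rs]] .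
      have "g \<in> normalizing R" if "g \<in> carrier G" for g
        using frattini_argument[OF p(1) N(1) R that] NL LR subgroup.m_closed[OF NR] by (metis subsetD)
      then have "R \<lhd> G" using normal_if_normalizing[OF Rs] by blast
      then have "R = {\<one>}" using normal_prime_power_trivial[OF p(1) _ sylow_inD(3)[OF R]] by simp
      then show False using sylow_nontrivial[OF p(1) Ns R p(2)] by simp
    qed
    moreover have LN: "subgroup (L <#> N) G"
      using subgroup_set_mult[OF Ls Ns] normalizing_normal[OF N(1)] subgroup.subset[OF Ls] by simp
    ultimately have "L <#> N = carrier G"
      using maximal_subgroupD(3)[OF L(1) LN] subset_set_mult[OF Ls Ns] by blast
    then have "card N * (i * card (L \<inter> N)) = card N * card L"
      using card_set_mult[OF Ls Ns] i by (simp add: ac_simps)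
    then have "i * card (L \<inter> N) = card L" using subgroup_card_pos[OF Ns] by (simp only: nat_mult_eq_cancel1)
    then show ?thesis by (metis dvd_triv_left)
  qed
  have "i = 1" using two_nonnormal_maximals idvd by (metis coprime_common_divisor_nat)
  then show ?thesis using i card_subset_eq[OF fin subgroup.subset[OF Ns]] by simp
qed

section \<open>Maximal subgroups of the simple group and the count of their conjugates\<close>

text \<open>By simplicity a normal maximal subgroup is trivial, hence contained in, and so equal to,
  a non-normal one.\<close>

lemma maximal_not_normal:
  assumes M: "maximal_subgroup M G"
  shows "\<not> M \<lhd> G"
proof
  assume "M \<lhd> G"
  then have M1: "M = {\<one>}" using simple maximal_subgroupD(2)[OF M] by blast
  obtain L where L: "maximal_subgroup L G" "\<not> L \<lhd> G" using two_nonnormal_maximals by metis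
  then have "M \<subseteq> L" using subgroup_one[OF maximal_subgroupD(1)[OF L(1)]] M1 by simp
  then have "L = M" using maximal_subgroupD(3)[OF M maximal_subgroupD(1)[OF L(1)]] maximal_subgroupD(2)[OF L(1)] by blast
  then show False using L(2) \<open>M \<lhd> G\<close> by simp
qed

text \<open>Take a largest nontrivial intersection D of two distinct maximal subgroups M and N. By
  simplicity N(D) is proper, so it lies in a maximal L. Normalizers grow in the nilpotent groups M
  and N, which forces both to equal L.\<close>

lemma maximal_Int_trivial:
  assumes "maximal_subgroup M1 G" "maximal_subgroup M2 G" "M1 \<noteq> M2"
  shows "M1 \<inter> M2 = {\<one>}"
proof (rule ccontr)
  assume ne: "M1 \<inter> M2 \<noteq> {\<one>}"
  define A where "A = {D. \<exists>M N. D = M \<inter> N \<and> maximal_subgroup M G \<and> maximal_subgroup N G \<and> M \<noteq> N \<and> D \<noteq> {\<one>}}"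
  have "A \<subseteq> Pow (carrier G)" using subgroup.subset maximal_subgroupD(1) by (fastforce simp: A_def)
  then have "finite A" using finite_subset finite_Pow_iff fin by metis
  moreover have "M1 \<inter> M2 \<in> A" using ne assms by (auto simp: A_def)
  ultimately obtain D where D: "D \<in> A" "\<forall>E\<in>A. D \<subseteq> E \<longrightarrow> D = E"
    using finite_has_maximal[of A] by blast
  then obtain M N where MN: "D = M \<inter> N" "maximal_subgroup M G" "maximal_subgroup N G" "M \<noteq> N" "D \<noteq> {\<one>}"
    by (auto simp: A_def)
  note Ms = maximal_subgroupD(1)[OF MN(2)] and Ns = maximal_subgroupD(1)[OF MN(3)]
  have Ds: "subgroup D G" unfolding MN(1) using Ms Ns by (rule subgroups_Inter_pair)
  have "\<not> D \<lhd> G"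
    using simple[of D] MN(1,5) maximal_subgroupD(2)[OF MN(2)] subgroup.subset[OF Ms] by blast
  then have "normalizing D \<noteq> carrier G" using normal_if_normalizing[OF Ds] by auto
  then obtain L where L: "maximal_subgroup L G" "normalizing D \<subseteq> L"
    using maximal_subgroup_exists[OF subgroup_normalizing[OF subgroup.subset[OF Ds]]] by blast
  \<comment> \<open>If K differed from L, their intersection would contain D together with an
    element x of K outside D that normalizes D, against the choice of D.\<close>
  have "K = L" if K: "maximal_subgroup K G" "K' \<noteq> K" "maximal_subgroup K' G" "D = K \<inter> K'" for K K'
  proof (rule ccontr)
    assume "K \<noteq> L"
    note Ks = maximal_subgroupD(1)[OF K(1)]
    have "D \<noteq> K"
      using maximal_subgroupD(3)[OF K(1) maximal_subgroupD(1)[OF K(3)]] maximal_subgroupD(2)[OF K(3)] K(2,4) by blast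
    then obtain x where x: "x \<in> K" "x \<notin> D" "x \<in> normalizing D"
      using nilpotent_normalizer_grows[OF Ks nilpotent_if_not_normal[OF K(1) maximal_not_normal[OF K(1)]] Ds] K(4) by blast
    have sub: "D \<subseteq> K \<inter> L" using K(4) L(2) subset_normalizing[OF Ds] by blast
    moreover have "x \<in> K \<inter> L" "x \<noteq> \<one>" using x L(2) subgroup_one[OF Ds] by auto
    then have "K \<inter> L \<noteq> {\<one>}" by blast
    ultimately have "D = K \<inter> L" using D(2) K(1) L(1) \<open>K \<noteq> L\<close> by (auto simp: A_def)
    then show False using x L(2) by blast
  qed
  from this[OF MN(2) _ MN(3,1)] this[OF MN(3) _ MN(2)] show False using MN(1,4) by blast
qed

lemma conjs_maximal:
  assumes M: "maximal_subgroup M G" and g: "g \<in> carrier G"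
  shows "maximal_subgroup (conjs g M) G"
  unfolding maximal_subgroup_def
proof (intro conjI allI impI)
  note Ms = maximal_subgroupD(1)[OF M]
  show "subgroup (conjs g M) G" using conjs_subgroup[OF g Ms] .
  show "conjs g M \<noteq> carrier G"
  proof
    assume "conjs g M = carrier G"
    then have "card M = card (carrier G)" using card_conjs[OF g subgroup.subset[OF Ms]] by simp
    then show False
      using card_subset_eq[OF fin subgroup.subset[OF Ms]] maximal_subgroupD(2)[OF M] by blast
  qed
  fix H assume H: "subgroup H G \<and> conjs g M \<subseteq> H"
  have Hc: "H \<subseteq> carrier G" using H subgroup.subset by blast
  have "M \<subseteq> conjs (inv g) H"
    using conjs_mono[of "conjs g M" H "inv g"] H conjs_inv1[OF g subgroup.subset[OF Ms]] by simp
  then have "conjs (inv g) H = M \<or> conjs (inv g) H = carrier G"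
    using maximal_subgroupD(3)[OF M conjs_subgroup] g H by simp
  then have "H = conjs g M \<or> H = conjs g (carrier G)"
    using conjs_inv2[OF g Hc] by metis
  then show "H = conjs g M \<or> H = carrier G" using normal_conjs[OF normal_self g] by simp
qed

text \<open>M is self-normalizing, so it has |G|/|M| conjugates. They meet pairwise trivially and
  together contain (|G|/|M|)(|M| - 1) nonidentity elements, at least half of |G| since |M| is at
  least 2.\<close>

lemma card_conjugates_union:
  assumes M: "maximal_subgroup M G" and ne: "card M \<noteq> 1"
  shows "card (carrier G) \<le> 2 * card (\<Union>g\<in>carrier G. conjs g M - {\<one>})"
proof -
  note Ms = maximal_subgroupD(1)[OF M]
  define F where "F = (\<lambda>g. conjs g M) ` carrier G"
  have finF: "finite F" by (simp add: F_def)
  have "normalizing M \<noteq> carrier G"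
    using normal_if_normalizing[OF Ms] maximal_not_normal[OF M] by auto
  then have NM: "normalizing M = M"
    using maximal_subgroupD(3)[OF M subgroup_normalizing[OF subgroup.subset[OF Ms]] subset_normalizing[OF Ms]] by blast
  have fib: "card {g \<in> carrier G. conjs g M = Y} = card M" if "Y \<in> F" for Y
  proof -
    obtain h where h: "h \<in> carrier G" "Y = conjs h M" using \<open>Y \<in> F\<close> by (auto simp: F_def)
    \<comment> \<open>The elements conjugating M to hMh^-1 form the coset hM, because N(M) =
      M.\<close>
    have "{g \<in> carrier G. conjs g M = Y} = (\<lambda>m. h \<otimes> m) ` M"
    proof (intro equalityI subsetI)
      fix g assume g: "g \<in> {g \<in> carrier G. conjs g M = Y}"
      then have "conjs (inv h \<otimes> g) M = M"
        using h conjs_inv1[OF h(1) subgroup.subset[OF Ms]] conjs_mult[of "inv h" g M] subgroup.subset[OF Ms] by simp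
      then have "inv h \<otimes> g \<in> M" using g h NM by (auto simp: normalizing_def)
      moreover have "g = h \<otimes> (inv h \<otimes> g)" using g h by (simp add: m_assoc[symmetric])
      ultimately show "g \<in> (\<lambda>m. h \<otimes> m) ` M" by blast
    next
      fix g assume "g \<in> (\<lambda>m. h \<otimes> m) ` M"
      then obtain m where m: "m \<in> M" "g = h \<otimes> m" by blast
      have mc: "m \<in> carrier G" using m Ms subgroup.mem_carrier by metis
      have "conjs m M = M" using m NM by (auto simp: normalizing_def)
      then show "g \<in> {g \<in> carrier G. conjs g M = Y}"
        using m mc h conjs_mult[OF h(1) mc subgroup.subset[OF Ms]] by simp
    qed
    moreover have "inj_on (\<lambda>m. h \<otimes> m) M"
      using h subgroup.subset[OF Ms] by (intro inj_onI) (simp add: subset_iff)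
    ultimately show ?thesis by (simp add: card_image)
  qed
  have cG: "card (carrier G) = card F * card M"
    using sum.image_gen[OF fin, of "\<lambda>_. 1::nat" "\<lambda>g. conjs g M"] fib
    by (simp add: F_def card_eq_sum[symmetric])
  have cY: "card (Y - {\<one>}) = card M - 1" if "Y \<in> F" for Y
  proof -
    obtain h where h: "h \<in> carrier G" "Y = conjs h M" using \<open>Y \<in> F\<close> by (auto simp: F_def)
    then show ?thesis
      using card_conjs[OF h(1) subgroup.subset[OF Ms]] subgroup_one[OF conjs_subgroup[OF h(1) Ms]] by simp
  qed
  have "card (\<Union>Y\<in>F. Y - {\<one>}) = (\<Sum>Y\<in>F. card (Y - {\<one>}))"
  proof (rule card_UN_disjoint[OF finF])
    have mY: "maximal_subgroup Y G" if "Y \<in> F" for Y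
      using that conjs_maximal[OF M] by (auto simp: F_def)
    then show "\<forall>Y\<in>F. finite (Y - {\<one>})" using maximal_subgroupD(1) subgroup_finite by blast
    show "\<forall>Y\<in>F. \<forall>Y'\<in>F. Y \<noteq> Y' \<longrightarrow> (Y - {\<one>}) \<inter> (Y' - {\<one>}) = {}"
      using maximal_Int_trivial mY by blast
  qed
  also have "\<dots> = card F * (card M - 1)" using cY by simp
  finally have "card (\<Union>g\<in>carrier G. conjs g M - {\<one>}) = card F * (card M - 1)"
    by (simp add: F_def)
  moreover have "card M \<le> 2 * (card M - 1)" using ne subgroup_card_pos[OF Ms] by simp
  ultimately show ?thesis using cG by (metis mult.left_commute mult_le_mono2)
qed

text \<open>Conjugates of L and of M differ in order, so they meet trivially. Their nonidentity
  elements then form two disjoint sets, each at least half as large as G, inside G without the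
  identity.\<close>

lemma contradiction: False
proof -
  obtain L M where L: "maximal_subgroup L G" "card L \<noteq> 1" and M: "maximal_subgroup M G" "card M \<noteq> 1"
    and co: "coprime (card L) (card M)" using two_nonnormal_maximals by metis
  define A where "A K = (\<Union>g\<in>carrier G. conjs g K - {\<one>})" for K
  have Ac: "A K \<subseteq> carrier G - {\<one>}" if "maximal_subgroup K G" for K
  proof -
    have "conjs g K \<subseteq> carrier G" if "g \<in> carrier G" for g
      using conjs_carrier[OF that subgroup.subset[OF maximal_subgroupD(1)]] \<open>maximal_subgroup K G\<close> by blast
    then show ?thesis unfolding A_def by blast
  qed
  have fA: "finite (A K)" if "maximal_subgroup K G" for K
    using Ac[OF that] finite_subset fin by blast
  have "A L \<inter> A M = {}"
  proof (rule ccontr)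
    assume "A L \<inter> A M \<noteq> {}"
    then obtain x g h where x: "g \<in> carrier G" "h \<in> carrier G" "x \<in> conjs g L" "x \<in> conjs h M" "x \<noteq> \<one>"
      by (auto simp: A_def)
    then have "conjs g L = conjs h M"
      using maximal_Int_trivial[OF conjs_maximal[OF L(1)] conjs_maximal[OF M(1)]] by blast
    then have "card L = card M"
      using card_conjs x subgroup.subset maximal_subgroupD(1) L(1) M(1) by metis
    then show False using co L(2) by simp
  qed
  then have "card (A L) + card (A M) = card (A L \<union> A M)"
    using card_Un_disjoint fA L(1) M(1) by metis
  also have "\<dots> \<le> card (carrier G - {\<one>})" using Ac L(1) M(1) fin by (intro card_mono) auto
  also have "\<dots> < card (carrier G)" by (rule card_Diff1_less[OF fin one_closed])
  finally show False
    using card_conjugates_union[OF L] card_conjugates_union[OF M] by (simp add: A_def)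
qed

end

section \<open>Passage to quotients\<close>

text \<open>Every commutator generating a term of the lower central series of B lifts along k, so
  each term is covered by the image of the corresponding term of A.\<close>

lemma nilpotent_epimorphic_image:
  assumes "group_hom A B k" and surj: "k ` carrier A = carrier B" and nil: "nilpotent_group A"
  shows "nilpotent_group B"
proof -
  interpret k: group_hom A B k by fact
  have sub: "lower_central B n \<subseteq> k ` lower_central A n" for n
  proof (induction n)
    case 0
    show ?case using surj by simp
  next
    case (Suc n)
    let ?C = "{x \<otimes>\<^bsub>A\<^esub> y \<otimes>\<^bsub>A\<^esub> inv\<^bsub>A\<^esub> x \<otimes>\<^bsub>A\<^esub> inv\<^bsub>A\<^esub> y | x y. x \<in> lower_central A n \<and> y \<in> carrier A}"
    have c: "lower_central A n \<subseteq> carrier A" by (rule lower_central_subset) (rule k.G.is_group)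
    have "lower_central B (Suc n) \<subseteq> generate B (k ` ?C)"
      unfolding lower_central.simps
    proof (rule k.H.mono_generate, clarify)
      fix x y assume "x \<in> lower_central B n" "y \<in> carrier B"
      then obtain a b where ab: "a \<in> lower_central A n" "b \<in> carrier A" "x = k a" "y = k b"
        using Suc surj by blast
      then have "x \<otimes>\<^bsub>B\<^esub> y \<otimes>\<^bsub>B\<^esub> inv\<^bsub>B\<^esub> x \<otimes>\<^bsub>B\<^esub> inv\<^bsub>B\<^esub> y
          = k (a \<otimes>\<^bsub>A\<^esub> b \<otimes>\<^bsub>A\<^esub> inv\<^bsub>A\<^esub> a \<otimes>\<^bsub>A\<^esub> inv\<^bsub>A\<^esub> b)"
        using c by (simp add: subset_iff)
      then show "x \<otimes>\<^bsub>B\<^esub> y \<otimes>\<^bsub>B\<^esub> inv\<^bsub>B\<^esub> x \<otimes>\<^bsub>B\<^esub> inv\<^bsub>B\<^esub> y \<in> k ` ?C" using ab by blast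
    qed
    also have "generate B (k ` ?C) = k ` generate A ?C"
      by (rule k.generate_img) (use c in auto)
    finally show ?case by simp
  qed
  obtain n where n: "lower_central A n = {\<one>\<^bsub>A\<^esub>}" using nil by (auto simp: nilpotent_group_def)
  have "\<one>\<^bsub>B\<^esub> \<in> lower_central B n" by (cases n) (auto intro: generate.one)
  then have "lower_central B n = {\<one>\<^bsub>B\<^esub>}" using sub[of n] n by auto
  then show ?thesis unfolding nilpotent_group_def by blast
qed

section \<open>Correspondence of subgroups under an epimorphism\<close>

locale finite_epimorphism = group_hom G H h + G: finite_group G + H: finite_group H
  for G (structure) and H (structure) and h +
  assumes surj: "h ` carrier G = carrier H"
begin

definition pre :: "'c set \<Rightarrow> 'a set" where
  "pre P = {g \<in> carrier G. h g \<in> P}"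

lemma image_pre: "P \<subseteq> carrier H \<Longrightarrow> h ` pre P = P"
proof -
  assume "P \<subseteq> carrier H"
  moreover have "h ` pre P = h ` carrier G \<inter> P" by (auto simp: pre_def)
  ultimately show ?thesis using surj by auto
qed

lemma subgroup_pre:
  assumes P: "subgroup P H"
  shows "subgroup (pre P) G"
proof (rule G.subgroupI)
  have "\<one> \<in> pre P" using subgroup.one_closed[OF P] by (simp add: pre_def)
  then show "pre P \<noteq> {}" by blast
qed (simp_all add: pre_def subset_iff subgroup.m_closed[OF P] subgroup.m_inv_closed[OF P])

lemma normal_pre:
  assumes P: "P \<lhd> H"
  shows "pre P \<lhd> G"
  unfolding G.normal_inv_iff
  using subgroup_pre[OF normal_imp_subgroup[OF P]] H.normal_invE(2)[OF P] by (auto simp: pre_def)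

lemma kernel_subset_pre: "subgroup P H \<Longrightarrow> kernel G H h \<subseteq> pre P"
  using subgroup.one_closed by (fastforce simp: pre_def kernel_def)

text \<open>Each fibre of h over P is a coset of the kernel.\<close>

lemma card_pre:
  assumes P: "subgroup P H"
  shows "card (pre P) = card P * card (kernel G H h)"
proof -
  have fib: "card {x \<in> pre P. h x = y} = card (kernel G H h)" if y: "y \<in> P" for y
  proof -
    have "y \<in> h ` carrier G" unfolding surj using y P by (simp add: subgroup.mem_carrier)
    then obtain g where g: "g \<in> carrier G" "h g = y" by blast
    have "{x \<in> pre P. h x = y} = (\<lambda>z. z \<otimes> g) ` kernel G H h"
    proof (intro equalityI subsetI)
      fix x assume "x \<in> {x \<in> pre P. h x = y}"
      then have x: "x \<in> carrier G" "h x = y" by (auto simp: pre_def)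
      then have "x \<otimes> inv g \<in> kernel G H h"
        using g subgroup.mem_carrier[OF P y] by (simp add: kernel_def)
      moreover have "x = x \<otimes> inv g \<otimes> g" using x g by (simp add: G.m_assoc)
      ultimately show "x \<in> (\<lambda>z. z \<otimes> g) ` kernel G H h" by blast
    next
      fix x assume "x \<in> (\<lambda>z. z \<otimes> g) ` kernel G H h"
      then obtain z where z: "z \<in> carrier G" "h z = \<one>\<^bsub>H\<^esub>" "x = z \<otimes> g" by (auto simp: kernel_def)
      then have "h x = y" using g subgroup.mem_carrier[OF P y] by simp
      then show "x \<in> {x \<in> pre P. h x = y}" using z g y by (simp add: pre_def)
    qed
    moreover have "inj_on (\<lambda>z. z \<otimes> g) (kernel G H h)"
      using g by (intro inj_onI) (simp add: kernel_def)
    ultimately show ?thesis by (simp add: card_image)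
  qed
  have "finite (pre P)" using G.fin by (auto simp: pre_def)
  from sum.image_gen[OF this, of "\<lambda>_. 1::nat" h] image_pre[OF subgroup.subset[OF P]] fib
  show ?thesis by (simp add: card_eq_sum[symmetric])
qed

lemma normal_image:
  assumes "T \<lhd> G"
  shows "h ` T \<lhd> H"
  by (rule normal.surj_hom_normal_subgroup[OF assms _ surj]) (rule group_hom_axioms)

lemma pre_image:
  assumes T: "subgroup T G" and ker: "kernel G H h \<subseteq> T"
  shows "pre (h ` T) = T"
proof (intro equalityI subsetI)
  fix x assume "x \<in> pre (h ` T)"
  then obtain t where t: "x \<in> carrier G" "t \<in> T" "h x = h t" by (auto simp: pre_def)
  have tc: "t \<in> carrier G" using t T subgroup.mem_carrier by metis
  have "x \<otimes> inv t \<in> T" using ker t tc by (auto simp: kernel_def)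
  then have "x \<otimes> inv t \<otimes> t \<in> T" using t T by (simp add: subgroup.m_closed)
  then show "x \<in> T" using t tc by (simp add: G.m_assoc)
qed (use T subgroup.mem_carrier in \<open>fastforce simp: pre_def\<close>)

lemma card_image_kernel:
  assumes "subgroup T G" "kernel G H h \<subseteq> T"
  shows "card T = card (h ` T) * card (kernel G H h)"
  using card_pre[OF subgroup_img_is_subgroup[OF assms(1)]] pre_image[OF assms] by simp

lemma maximal_pre:
  assumes M: "maximal_subgroup M H"
  shows "maximal_subgroup (pre M) G"
  unfolding maximal_subgroup_def
proof (intro conjI allI impI)
  note Ms = H.maximal_subgroupD(1)[OF M]
  show "subgroup (pre M) G" using subgroup_pre[OF Ms] .
  show "pre M \<noteq> carrier G"
    using image_pre[OF subgroup.subset[OF Ms]] surj H.maximal_subgroupD(2)[OF M] by auto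
  fix K assume K: "subgroup K G \<and> pre M \<subseteq> K"
  then have ker: "kernel G H h \<subseteq> K" using kernel_subset_pre[OF Ms] by blast
  have "M \<subseteq> h ` K" using K image_pre[OF subgroup.subset[OF Ms]] by blast
  then have "h ` K = M \<or> h ` K = carrier H"
    using H.maximal_subgroupD(3)[OF M] subgroup_img_is_subgroup K by blast
  moreover have "pre (carrier H) = carrier G" by (auto simp: pre_def)
  ultimately show "K = pre M \<or> K = carrier G" using pre_image[OF _ ker] K by metis
qed

text \<open>The preimage of a maximal subgroup is maximal, hence nilpotent or normal, and both
  properties pass to images under h.\<close>

lemma nonnilpotent_maximal_normal_image:
  assumes "G.nonnilpotent_maximal_normal"
  shows "H.nonnilpotent_maximal_normal"
  unfolding H.nonnilpotent_maximal_normal_def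
proof (intro allI impI)
  fix M assume M: "maximal_subgroup M H"
  note Ms = H.maximal_subgroupD(1)[OF M]
  have im: "h ` pre M = M" using image_pre[OF subgroup.subset[OF Ms]] .
  from maximal_pre[OF M] have "nilpotent_group (G\<lparr>carrier := pre M\<rparr>) \<or> pre M \<lhd> G"
    using assms by (auto simp: G.nonnilpotent_maximal_normal_def)
  then show "nilpotent_group (H\<lparr>carrier := M\<rparr>) \<or> M \<lhd> H"
  proof
    assume nil: "nilpotent_group (G\<lparr>carrier := pre M\<rparr>)"
    have "group_hom (G\<lparr>carrier := pre M\<rparr>) (H\<lparr>carrier := M\<rparr>) h"
    proof (rule group_hom.intro)
      show "group_hom_axioms (G\<lparr>carrier := pre M\<rparr>) (H\<lparr>carrier := M\<rparr>) h"
        by unfold_locales (auto simp: hom_def pre_def)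
    qed (use G.subgroup_imp_group[OF subgroup_pre[OF Ms]] H.subgroup_imp_group[OF Ms] in auto)
    from nilpotent_epimorphic_image[OF this _ nil] show ?thesis using im by simp
  next
    assume "pre M \<lhd> G"
    then show ?thesis using normal_image[of "pre M"] im by simp
  qed
qed

lemma card_kernel_pos: "card (kernel G H h) > 0"
  using G.subgroup_card_pos[OF subgroup_kernel] .

lemma card_carrier: "card (carrier G) = card (carrier H) * card (kernel G H h)"
  using card_image_kernel[OF G.subgroup_self] surj by (auto simp: kernel_def)

text \<open>Normal subgroups above the kernel correspond to those of H, and all orders change by the
  same factor, the order of the kernel, which cancels.\<close>

lemma rel_image:
  assumes P: "subgroup P H" and good: "G.rel_q_nilpotent q (pre P) \<or> G.rel_q_closed q (pre P)"
  shows "H.rel_q_nilpotent q P \<or> H.rel_q_closed q P"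
proof -
  have T: "h ` T \<lhd> H \<and> P \<subseteq> h ` T \<and> card T = card (h ` T) * card (kernel G H h)"
    if "T \<lhd> G" "pre P \<subseteq> T" for T
    using that normal_image[OF that(1)] image_pre[OF subgroup.subset[OF P]] kernel_subset_pre[OF P]
      card_image_kernel[OF normal_imp_subgroup[OF that(1)]] by blast
  from good show ?thesis
  proof
    assume "G.rel_q_nilpotent q (pre P)"
    then obtain T m k where T': "T \<lhd> G" "pre P \<subseteq> T" "card T = card (pre P) * m" "coprime m q"
      "card (carrier G) = card T * q ^ k" unfolding G.rel_q_nilpotent_def by blast
    have "card (h ` T) = card P * m" "card (carrier H) = card (h ` T) * q ^ k"
      using T[OF T'(1,2)] T' card_pre[OF P] card_carrier card_kernel_pos by simp_all
    then show ?thesis using T[OF T'(1,2)] T'(4) unfolding H.rel_q_nilpotent_def by blast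
  next
    assume "G.rel_q_closed q (pre P)"
    then obtain T m k where T': "T \<lhd> G" "pre P \<subseteq> T" "card T = card (pre P) * q ^ k" "coprime m q"
      "card (carrier G) = card T * m" unfolding G.rel_q_closed_def by blast
    have "card (h ` T) = card P * q ^ k" "card (carrier H) = card (h ` T) * m"
      using T[OF T'(1,2)] T' card_pre[OF P] card_carrier card_kernel_pos by simp_all
    then show ?thesis using T[OF T'(1,2)] T'(4) unfolding H.rel_q_closed_def by blast
  qed
qed

text \<open>Pulls the property of the image group back to G, where the kernel takes the place of the
  trivial subgroup.\<close>

lemma rel_pre:
  assumes "H.rel_q_nilpotent q {\<one>\<^bsub>H\<^esub>} \<or> H.rel_q_closed q {\<one>\<^bsub>H\<^esub>}"
  shows "G.rel_q_nilpotent q (kernel G H h) \<or> G.rel_q_closed q (kernel G H h)"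
proof -
  have T: "pre T \<lhd> G \<and> kernel G H h \<subseteq> pre T \<and> card (pre T) = card T * card (kernel G H h)"
    if "T \<lhd> H" for T
    using normal_pre[OF that] kernel_subset_pre card_pre normal_imp_subgroup[OF that] by blast
  from assms show ?thesis
  proof
    assume "H.rel_q_nilpotent q {\<one>\<^bsub>H\<^esub>}"
    then obtain T m k where T': "T \<lhd> H" "card T = m" "coprime m q" "card (carrier H) = card T * q ^ k"
      unfolding H.rel_q_nilpotent_def by auto
    have "card (pre T) = card (kernel G H h) * m" "card (carrier G) = card (pre T) * q ^ k"
      using T[OF T'(1)] T' card_carrier by simp_all
    then show ?thesis using T[OF T'(1)] T'(3) unfolding G.rel_q_nilpotent_def by blast
  next
    assume "H.rel_q_closed q {\<one>\<^bsub>H\<^esub>}"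
    then obtain T m k where T': "T \<lhd> H" "card T = q ^ k" "coprime m q" "card (carrier H) = card T * m"
      unfolding H.rel_q_closed_def by auto
    have "card (pre T) = card (kernel G H h) * q ^ k" "card (carrier G) = card (pre T) * m"
      using T[OF T'(1)] T' card_carrier by simp_all
    then show ?thesis using T[OF T'(1)] T'(3) unfolding G.rel_q_closed_def by blast
  qed
qed

end

section \<open>Induction over quotients and the conclusion\<close>

lemma (in finite_group) finite_epimorphism_FactGroup:
  assumes N: "N \<lhd> G"
  shows "finite_epimorphism G (G Mod N) (\<lambda>g. N #> g)" "kernel G (G Mod N) (\<lambda>g. N #> g) = N"
proof -
  have Ns: "subgroup N G" using N by (rule normal_imp_subgroup)
  interpret X: group "G Mod N" using N by (rule normal.factorgroup_is_group)
  show "finite_epimorphism G (G Mod N) (\<lambda>g. N #> g)"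
    by unfold_locales (use normal.r_coset_hom_Mod[OF N] in \<open>auto simp: carrier_FactGroup\<close>)
  show "kernel G (G Mod N) (\<lambda>g. N #> g) = N"
    using coset_join1[OF _ _ Ns] coset_join2[OF _ Ns] subgroup.subset[OF Ns] by (auto simp: kernel_def)
qed

text \<open>Induction on |G| - |N|. If G/N failed, it would be a minimal counterexample: a
  nontrivial normal subgroup of G/N pulls back to a larger normal subgroup of G, to which the
  induction hypothesis applies.\<close>

lemma (in finite_group) rel_q_nilpotent_or_closed:
  assumes max: "nonnilpotent_maximal_normal" and q: "Factorial_Ring.prime q" and N: "N \<lhd> G"
  shows "rel_q_nilpotent q N \<or> rel_q_closed q N"
  using N
proof (induction "card (carrier G) - card N" arbitrary: N rule: less_induct)
  case less
  let ?X = "G Mod N" and ?h = "\<lambda>g. N #> g"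
  note ker = finite_epimorphism_FactGroup(2)[OF less.prems]
  interpret h: finite_epimorphism G ?X ?h by (rule finite_epimorphism_FactGroup(1)[OF less.prems])
  have "h.H.rel_q_nilpotent q {\<one>\<^bsub>?X\<^esub>} \<or> h.H.rel_q_closed q {\<one>\<^bsub>?X\<^esub>}"
  proof (rule ccontr)
    assume a: "\<not> ?thesis"
    have "minimal_counterexample ?X q"
    proof unfold_locales
      show "Factorial_Ring.prime q" by (rule q)
      show "h.H.nonnilpotent_maximal_normal" using h.nonnilpotent_maximal_normal_image[OF max] .
      show "\<not> h.H.rel_q_nilpotent q {\<one>\<^bsub>?X\<^esub>}" "\<not> h.H.rel_q_closed q {\<one>\<^bsub>?X\<^esub>}" using a by auto
      fix P assume P: "P \<lhd> ?X" "P \<noteq> {\<one>\<^bsub>?X\<^esub>}"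
      have Ps: "subgroup P ?X" using P(1) by (rule normal_imp_subgroup)
      have "card P \<noteq> 1" using P(2) subgroup.one_closed[OF Ps] by (metis card_1_singletonE singletonD)
      then have "card P > 1" using h.H.subgroup_card_pos[OF Ps] by simp
      then have "card N < card (h.pre P)" using h.card_pre[OF Ps] h.card_kernel_pos by (simp add: ker)
      moreover have "card (h.pre P) \<le> card (carrier G)"
        using subgroup.subset[OF h.subgroup_pre[OF Ps]] by (simp add: card_mono)
      ultimately have "rel_q_nilpotent q (h.pre P) \<or> rel_q_closed q (h.pre P)"
        using less.hyps[OF _ h.normal_pre[OF P(1)]] by simp
      then show "h.H.rel_q_nilpotent q P \<or> h.H.rel_q_closed q P" using h.rel_image[OF Ps] by simp
    qed
    then show False by (rule minimal_counterexample.contradiction)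
  qed
  then show ?case using h.rel_pre ker by simp
qed

theorem theorem1p8:
  fixes G :: "('a, 'b) monoid_scheme"
  assumes "group G" and "finite (carrier G)"
    and "\<And>M. maximal_subgroup M G \<Longrightarrow> nilpotent_group (G\<lparr>carrier := M\<rparr>) \<or> M \<lhd> G"
  shows "\<forall>q::nat. Factorial_Ring.prime q \<and> q dvd card (carrier G) \<longrightarrow> q_nilpotent G q \<or> q_closed G q"
proof (intro allI impI)
  fix q :: nat
  assume "Factorial_Ring.prime q \<and> q dvd card (carrier G)"
  then have q: "Factorial_Ring.prime q" by simp
  interpret finite_group G
    using assms(1,2) by (simp add: finite_group_def finite_group_axioms_def)
  have "nonnilpotent_maximal_normal" using assms(3) by (simp add: nonnilpotent_maximal_normal_def)
  then have "rel_q_nilpotent q {\<one>\<^bsub>G\<^esub>} \<or> rel_q_closed q {\<one>\<^bsub>G\<^esub>}"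
    using rel_q_nilpotent_or_closed[OF _ q one_is_normal] by simp
  then show "q_nilpotent G q \<or> q_closed G q"
  proof
    assume "rel_q_nilpotent q {\<one>\<^bsub>G\<^esub>}"
    then show ?thesis unfolding rel_q_nilpotent_def q_nilpotent_def by auto
  next
    assume "rel_q_closed q {\<one>\<^bsub>G\<^esub>}"
    then obtain S m k where S: "S \<lhd> G" "card S = q ^ k" "coprime m q" "card (carrier G) = card S * m"
      unfolding rel_q_closed_def by auto
    \<comment> \<open>As m is prime to q, the order q^k of S is the full q-part of |G|.\<close>
    have "\<not> q dvd m" using S(3) q by (metis coprime_common_divisor_nat dvd_refl not_prime_1)
    then have "card S = q ^ multiplicity q (card (carrier G))"
      using multiplicity_prime_power_mult[OF q] S by simp
    then show ?thesis using S(1) normal_imp_subgroup[OF S(1)] unfolding q_closed_def by blast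
  qed
qed

end
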